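(* Let $\lambda\in\mathbb{D}$, $z_0\in\mathbb{D}\setminus\{0\}$ and $\alpha\in\mathbb{C}$ with $\mathrm{Re}\,\alpha>0$. Then the boundary $\partial V_{\mathcal{G}}(z_0,\lambda)$ is the Jordan curve given by $$\begin{aligned}(-\pi,\pi]\ni\theta\mapsto\ & (1-\alpha)F_{e^{i\theta},\lambda}(z_0)+\alpha z_0F'_{e^{i\theta},\lambda}(z_0)\\ &=(2\beta-1)z_0+\frac{(1-\beta)e^{-i\theta/2}}{\sqrt{1-b^2}}\Bigg[\left(1+\overline{\lambda}e^{i\theta/2}(-\sqrt{1-b^2}+ib)\right)\log\left(1+\frac{e^{i\theta/2}z_0}{\sqrt{1-b^2}-ib}\right)\\ &\qquad-\left(1+\overline{\lambda}e^{i\theta/2}(\sqrt{1-b^2}+ib)\right)\log\left(1-\frac{e^{i\theta/2}z_0}{\sqrt{1-b^2}+ib}\right)\Bigg],\end{aligned}$$ where $b=\mathrm{Im}(\overline{\lambda}e^{i\theta/2})$. Moreover, if $$(1-\alpha)f(z_0)+\alpha z_0f'(z_0)=(1-\alpha)F_{e^{i\theta},\lambda}(z_0)+\alpha z_0F'_{e^{i\theta},\lambda}(z_0)$$ for some $f\in\mathcal{G}(\lambda)$ and some $\theta\in(-\pi,\pi]$, then $f(z)=F_{e^{i\theta},\lambda}(z)$ for all $z\in\mathbb{D}$.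
   Context: $\mathbb{D}=\{z\in\mathbb{C}:|z|<1\}$, and $\mathcal{A}$ is the class of analytic functions $f$ on $\mathbb{D}$ with $f(0)=0=f'(0)-1$. Fix a real number $\beta$ with $0\le\beta<1$. For $\alpha\in\mathbb{C}$ with $\mathrm{Re}\,\alpha>0$, $\mathcal{F}(\alpha,\beta)$ is the class of $f\in\mathcal{A}$ such that $f'(z)+\alpha zf''(z)\prec\frac{1+(1-2\beta)z}{1-z}$ in $\mathbb{D}$, where $\prec$ is subordination ($g\prec h$ means $g=h\circ\omega$ for some analytic $\omega:\mathbb{D}\to\mathbb{D}$ with $\omega(0)=0$). For $\lambda\in\overline{\mathbb{D}}$ and $z_0\in\mathbb{D}$ set $$\mathcal{G}(\lambda)=\left\{f\in\mathcal{F}(\alpha,\beta):\ f''(0)=2\left(\frac{1-\beta}{1+\alpha}\right)\lambda\right\},\qquad V_{\mathcal{G}}(z_0,\lambda)=\{(1-\alpha)f(z_0)+\alpha z_0f'(z_0):\ f\in\mathcal{G}(\lambda)\}.$$ For $\lambda\in\mathbb{D}$ let $\delta(z,\lambda)=\frac{z+\lambda}{1+\overline{\lambda}z}$. For $\theta\in\mathbb{R}$, $F_{e^{i\theta},\lambda}\in\mathcal{A}$ is the function determined by $$(1-\alpha)F_{e^{i\theta},\lambda}(z)+\alpha zF'_{e^{i\theta},\lambda}(z)=\int_0^z\frac{1+(1-2\beta)\delta(e^{i\theta}\zeta,\lambda)\zeta}{1-\delta(e^{i\theta}\zeta,\lambda)\zeta}\,d\zeta,\quad z\in\mathbb{D}.$$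 Logarithms are principal branches. A Jordan curve is a simple closed curve. *)

theory Defs
  imports "HOL-Complex_Analysis.Complex_Analysis"
begin

abbreviation unit_disc :: "complex set" where
  "unit_disc \<equiv> ball 0 1"

text \<open>Functions on the unit disc are represented by total functions on the complex plane; every
  definition below looks only at their values on the (open) disc.\<close>

definition class_A :: "(complex \<Rightarrow> complex) set" where
  "class_A = {f. f holomorphic_on unit_disc \<and> f 0 = 0 \<and> deriv f 0 - 1 = 0}"

definition subordinate :: "(complex \<Rightarrow> complex) \<Rightarrow> (complex \<Rightarrow> complex) \<Rightarrow> bool" where
  "subordinate g h \<longleftrightarrow>
     (\<exists>\<omega>. \<omega> holomorphic_on unit_disc \<and> \<omega> ` unit_disc \<subseteq> unit_disc \<and> \<omega> 0 = 0 \<and>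
          (\<forall>z\<in>unit_disc. g z = h (\<omega> z)))"

definition half_plane_map :: "real \<Rightarrow> complex \<Rightarrow> complex" where
  "half_plane_map \<beta> w = (1 + (1 - 2 * of_real \<beta>) * w) / (1 - w)"

definition class_F :: "complex \<Rightarrow> real \<Rightarrow> (complex \<Rightarrow> complex) set" where
  "class_F \<alpha> \<beta> = {f \<in> class_A.
     subordinate (\<lambda>z. deriv f z + \<alpha> * z * deriv (deriv f) z) (half_plane_map \<beta>)}"

definition class_G :: "complex \<Rightarrow> real \<Rightarrow> complex \<Rightarrow> (complex \<Rightarrow> complex) set" where
  "class_G \<alpha> \<beta> lam = {f \<in> class_F \<alpha> \<beta>.
     deriv (deriv f) 0 = 2 * ((1 - of_real \<beta>) / (1 + \<alpha>)) * lam}"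

definition alpha_op :: "complex \<Rightarrow> (complex \<Rightarrow> complex) \<Rightarrow> complex \<Rightarrow> complex" where
  "alpha_op \<alpha> f z = (1 - \<alpha>) * f z + \<alpha> * z * deriv f z"

definition V_G :: "complex \<Rightarrow> real \<Rightarrow> complex \<Rightarrow> complex \<Rightarrow> complex set" where
  "V_G \<alpha> \<beta> z0 lam = {alpha_op \<alpha> f z0 | f. f \<in> class_G \<alpha> \<beta> lam}"

definition disc_aut :: "complex \<Rightarrow> complex \<Rightarrow> complex" where
  "disc_aut z lam = (z + lam) / (1 + cnj lam * z)"

text \<open>\<open>F_fun \<alpha> \<beta> c lam\<close> is used for unimodular \<open>c\<close>. For \<open>Re \<alpha> > 0\<close>, comparing Taylor coefficients
  shows that the defining equation has exactly one solution in \<open>class_A\<close>, up to the irrelevant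
  values outside the disc; this is why a choice rather than a definite description is used.\<close>

definition F_fun :: "complex \<Rightarrow> real \<Rightarrow> complex \<Rightarrow> complex \<Rightarrow> complex \<Rightarrow> complex" where
  "F_fun \<alpha> \<beta> c lam = (SOME F. F \<in> class_A \<and>
     (\<forall>z\<in>unit_disc. alpha_op \<alpha> F z =
        contour_integral (linepath 0 z) (\<lambda>\<zeta>. half_plane_map \<beta> (disc_aut (c * \<zeta>) lam * \<zeta>))))"

end

theory Submission
  imports Defs
begin

text \<open>
  Let \<open>p = alpha_op \<alpha> f\<close>, so that \<open>p' = f' + \<alpha> z f''\<close>. The function \<open>f\<close> is recovered from \<open>p\<close> by solving
  an Euler equation (\<open>alpha_op_surj\<close>, \<open>alpha_op_inj\<close>), and two applications of Schwarz's lemma show that \<open>f\<close>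
  in \<open>class_G \<alpha> \<beta> lam\<close> has the form \<open>p' z = half_plane_map \<beta> (disc_aut (z * \<psi> z) lam * z)\<close> with \<open>\<psi>\<close>
  holomorphic and bounded by \<open>1\<close> (\<open>class_G_parameter\<close>). The extremal functions are those with \<open>\<psi>\<close>
  constant and unimodular.

  The heart of the proof is that each point of the curve is an exposed point of the variability
  region, attained by the extremal function alone (\<open>extremal_exposed\<close>). Fix \<open>c = cis \<theta>\<close>, let \<open>q\<close> belong to
  \<open>\<psi> = c\<close>, and put \<open>D = extremal_den c lam\<close>. At each \<open>z\<close> the possible values of \<open>p' z\<close> lie in a disc which
  has \<open>q' z\<close> on its boundary circle, with outward normal \<open>c z\<^sup>2 / D\<^sup>2\<close>; hence
  \<open>q' - p'\<close> is a positive constant times \<open>c R z\<^sup>2 / D\<^sup>2\<close>, where \<open>Re R > 0\<close> unless \<open>\<psi>\<close> is identically \<open>c\<close>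
  (\<open>extremal_diff\<close>, \<open>kernel_ratio_pos\<close>). The primitive \<open>K\<close> of \<open>z\<^sup>2 / D\<^sup>2\<close> is starlike
  (\<open>starlike_factor\<close>), and Libera's lemma (\<open>libera_quotient\<close>) integrates the pointwise inequality: the quotient
  \<open>(q - p) / (c K)\<close> also has positive real part. At \<open>z0\<close> this is a supporting half plane, with equality
  only for \<open>p = q\<close>. Starlikeness and Libera's lemma both follow from the touching argument
  \<open>Re_pos_by_touching_point\<close>.

  The curve therefore lies on the frontier and is injective on a period; it is continuous by
  the closed form with logarithms, which is checked by differentiating in \<open>z\<close>. Since the variability
  region is convex (\<open>convex_V_G\<close>), a Jordan curve contained both in it and in its frontier is the whole
  frontier (\<open>frontier_convex_eq_Jordan_curve\<close>).
\<close>

section \<open>Positive real part by a touching argument\<close>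

text \<open>
  If \<open>Re g\<close> failed to be positive, take a zero \<open>z\<close> of \<open>Re g\<close> of least modulus. On the circle through
  \<open>z\<close> the function \<open>Re g\<close> has a minimum at \<open>z\<close>, so its tangential derivative \<open>- Im (z g' z)\<close> vanishes;
  along the radius it decreases to \<open>0\<close>, so \<open>Re (z g' z) \<le> 0\<close>. In applications a differential equation for
  \<open>g\<close> excludes such a point. This is the mechanism of Jack's lemma and of Miller and Mocanu.
\<close>

lemma Re_pos_by_touching_point:
  assumes hol: "g holomorphic_on unit_disc" and g0: "Re (g 0) > 0"
    and touch: "\<And>z t. \<lbrakk>z \<in> unit_disc; Re (g z) = 0; z * deriv g z = of_real t; t \<le> 0\<rbrakk> \<Longrightarrow> False"
    and z': "z' \<in> unit_disc"
  shows "Re (g z') > 0"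
proof (rule ccontr)
  assume "\<not> ?thesis"
  then have z'neg: "Re (g z') \<le> 0"
    by force
  have cont: "continuous_on unit_disc (\<lambda>z. Re (g z))"
    using hol by (intro continuous_intros holomorphic_on_imp_continuous_on)
  define A where "A = {z \<in> cball 0 (norm z'). Re (g z) \<le> 0}"
  have sub: "cball 0 (norm z') \<subseteq> unit_disc"
    using z' by auto
  have "closed A"
    unfolding A_def
    by (intro continuous_on_closed_Collect_le continuous_on_subset[OF cont sub]) auto
  moreover have "bounded A"
    unfolding A_def by (rule bounded_subset[of "cball 0 (norm z')"]) auto
  ultimately have "compact A"
    by (simp add: compact_eq_bounded_closed)
  moreover have "A \<noteq> {}"
    using z'neg by (auto simp: A_def)
  ultimately obtain z where zA: "z \<in> A" and zmin: "\<And>y. y \<in> A \<Longrightarrow> norm z \<le> norm y"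
    using continuous_attains_inf[of A norm] continuous_on_norm_id by blast
  have z: "z \<in> unit_disc" "norm z \<le> norm z'" "Re (g z) \<le> 0"
    using zA sub by (auto simp: A_def)
  have z0: "z \<noteq> 0"
    using g0 z by auto
  have inner: "Re (g y) > 0" if "norm y < norm z" for y
    using zmin[of y] that z(2) by (force simp: A_def)
  have closed_disc: "Re (g y) \<ge> 0" if y: "norm y = norm z" for y
  proof (rule continuous_ge_on_closure[of "ball 0 (norm z)" "\<lambda>z. Re (g z)" y 0])
    show "continuous_on (closure (ball 0 (norm z))) (\<lambda>z. Re (g z))"
      using z0 z by (intro continuous_on_subset[OF cont]) auto
    show "y \<in> closure (ball 0 (norm z))" using y z0 by simp
  qed (use inner in \<open>auto simp: less_imp_le\<close>)
  have gz: "Re (g z) = 0"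
    using closed_disc[of z] z by simp
  have D: "(g has_field_derivative deriv g z) (at z)"
    using hol z by (intro holomorphic_derivI[of g unit_disc]) auto
  have line: "((\<lambda>t. Re (g (h t))) has_real_derivative Re (h' * deriv g z)) (at a)"
    if "(h has_vector_derivative h') (at a)" "h a = z" for h :: "real \<Rightarrow> complex" and h' a
  proof -
    have "((g \<circ> h) has_vector_derivative h' * deriv g z) (at a)"
      using field_vector_diff_chain_at[of h h' a g "deriv g z"] that D by simp
    then show ?thesis
      using bounded_linear.has_vector_derivative[OF bounded_linear_Re]
      by (fastforce simp: o_def has_real_derivative_iff_has_vector_derivative)
  qed
  have "((\<lambda>t. Re (g (z * cis t))) has_real_derivative Re (z * \<i> * deriv g z)) (at 0)"
  proof (rule line)
    show "((\<lambda>t. z * cis t) has_vector_derivative z * \<i>) (at 0)"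
      unfolding has_vector_derivative_def
      by (auto intro!: derivative_eq_intros simp: scaleR_conv_of_real)
  qed simp
  moreover have "\<forall>t. \<bar>0 - t\<bar> < 1 \<longrightarrow> Re (g (z * cis 0)) \<le> Re (g (z * cis t))"
    using closed_disc gz by (simp add: norm_mult)
  ultimately have "Re (z * \<i> * deriv g z) = 0"
    using DERIV_local_min[OF _ zero_less_one] by blast
  then have im: "Im (z * deriv g z) = 0"
    by (simp add: algebra_simps)
  have rad: "((\<lambda>t. Re (g (of_real t * z))) has_real_derivative Re (z * deriv g z)) (at 1)"
  proof (rule line)
    show "((\<lambda>t. of_real t * z) has_vector_derivative z) (at 1)"
      by (auto intro!: derivative_eq_intros simp: has_vector_derivative_def scaleR_conv_of_real)
  qed simp
  have "Re (z * deriv g z) \<le> 0"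
  proof (rule ccontr)
    assume "\<not> ?thesis"
    then obtain d where d: "d > 0" "\<And>h. 0 < h \<Longrightarrow> h < d \<Longrightarrow> Re (g (of_real (1 - h) * z)) < Re (g (of_real 1 * z))"
      using DERIV_pos_inc_left[OF rad] by force
    define h where "h = min (d/2) (1/2)"
    have h: "0 < h" "h < d" "h < 1" using d(1) by (auto simp: h_def)
    have "norm (of_real (1 - h) * z) < norm z"
      using h z0 unfolding norm_mult norm_of_real by (simp add: abs_of_pos)
    from inner[OF this] d(2)[OF h(1,2)] gz show False by simp
  qed
  moreover have "z * deriv g z = of_real (Re (z * deriv g z))"
    using im by (simp add: complex_eq_iff)
  ultimately show False
    using touch z(1) gz by blast
qed

section \<open>The Euler equation \<open>F + c z F' = P\<close>\<close>

text \<open>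
  The \<open>n\<close>-th Taylor coefficient is divided by \<open>1 + c n\<close>, whose modulus is at least \<open>1\<close>, so the radius
  of convergence does not shrink.
\<close>

lemma euler_equation_solvable:
  assumes hol: "P holomorphic_on unit_disc" and c: "Re c \<ge> 0"
  obtains F where "F holomorphic_on unit_disc"
    "\<And>z. z \<in> unit_disc \<Longrightarrow> F z + c * z * deriv F z = P z"
proof -
  define a where "a n = (deriv ^^ n) P 0 / fact n" for n
  define b where "b n = a n / (1 + c * of_nat n)" for n
  have P: "(\<lambda>n. a n * z ^ n) sums P z" if "z \<in> unit_disc" for z
    using holomorphic_power_series[OF hol that] by (simp add: a_def)
  have re: "Re (1 + c * of_nat n) \<ge> 1" for n
    using c by simp
  have "norm (1 + c * of_nat n) \<ge> 1" for n
    using re[of n] complex_Re_le_cmod[of "1 + c * of_nat n"] by linarith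
  then have ba: "norm (b n) \<le> norm (a n)" for n
    unfolding b_def norm_divide
    by (metis div_by_1 divide_left_mono mult_pos_pos norm_ge_zero order_less_le_trans zero_less_one)
  have nz: "1 + c * of_nat n \<noteq> 0" for n
    using re[of n] by (metis not_one_le_zero zero_complex.sel(1))
  have sb: "summable (\<lambda>n. b n * of_real r ^ n)" if r: "0 \<le> r" "r < 1" for r :: real
  proof -
    \<comment> \<open>Absolute convergence at \<open>r\<close> follows from convergence at a slightly larger radius.\<close>
    define s where "s = (r + 1) / 2"
    have s: "r < s" "s < 1" "0 < s" using r by (auto simp: s_def)
    have "summable (\<lambda>n. a n * of_real s ^ n)"
      using P[of "of_real s"] s by (auto simp: sums_iff)
    then have "summable (\<lambda>n. norm (a n * of_real r ^ n))"
      by (rule powser_insidea) (use r s in auto)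
    then show ?thesis
      by (rule summable_comparison_test'[of _ 0])
        (use ba r in \<open>auto simp: norm_mult norm_power intro: mult_right_mono\<close>)
  qed
  define F where "F z = (\<Sum>n. b n * z ^ n)" for z
  have main: "\<exists>D. (F has_field_derivative D) (at z) \<and> F z + c * z * D = P z"
    if z: "z \<in> unit_disc" for z
  proof -
    define r where "r = (norm z + 1) / 2"
    have r: "norm z < r" "r < 1" "0 \<le> r" using z by (auto simp: r_def field_simps)
    have sr: "summable (\<lambda>n. b n * (of_real r) ^ n)" using sb r by auto
    have DF: "(F has_field_derivative (\<Sum>n. diffs b n * z ^ n)) (at z)"
      unfolding F_def by (rule termdiffs_strong[OF sr]) (use r in auto)
    have "summable (\<lambda>n. diffs b n * z ^ n)"
      by (rule termdiff_converges[of z r]) (use r sb in \<open>auto intro: powser_inside[OF sr]\<close>)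
    from diffs_equiv[OF this]
    have 1: "(\<lambda>n. c * z * (of_nat n * b n * z ^ (n - Suc 0))) sums (c * z * (\<Sum>n. diffs b n * z ^ n))"
      by (rule sums_mult)
    have 2: "(\<lambda>n. b n * z ^ n) sums F z"
      unfolding F_def by (intro summable_sums powser_inside[OF sr]) (use r in auto)
    have "b n * z ^ n + c * z * (of_nat n * b n * z ^ (n - Suc 0)) = a n * z ^ n" for n
    proof -
      have "b n * z ^ n + c * z * (of_nat n * b n * z ^ (n - Suc 0)) = (1 + c * of_nat n) * b n * z ^ n"
        by (cases n) (auto simp: algebra_simps)
      then show ?thesis using nz[of n] by (simp add: b_def)
    qed
    with sums_add[OF 2 1] have "(\<lambda>n. a n * z ^ n) sums (F z + c * z * (\<Sum>n. diffs b n * z ^ n))"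
      by simp
    with P[OF z] DF show ?thesis
      using sums_unique2 by blast
  qed
  show ?thesis
  proof
    show "F holomorphic_on unit_disc"
      using main by (auto simp: holomorphic_on_open) (metis mem_ball_0)
    show "F z + c * z * deriv F z = P z" if "z \<in> unit_disc" for z
      using main[OF that] DERIV_imp_deriv by metis
  qed
qed

text \<open>
  A nonzero solution would have the form \<open>z^n g\<close> with \<open>n \<ge> 1\<close> and \<open>g 0 \<noteq> 0\<close>; comparing terms of order
  \<open>n\<close> gives \<open>1 - \<alpha> + \<alpha> n = 0\<close>, but the real part of this number is at least \<open>1\<close>. The normalization at
  the origin excludes \<open>n = 0\<close>, for which \<open>\<alpha> = 1\<close> would be an exception.
\<close>

lemma euler_equation_unique:
  assumes d: "d holomorphic_on unit_disc" "d 0 = 0" and \<alpha>: "Re \<alpha> > 0"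
    and eq: "\<And>z. z \<in> unit_disc \<Longrightarrow> (1 - \<alpha>) * d z + \<alpha> * z * deriv d z = 0"
    and z: "z \<in> unit_disc"
  shows "d z = 0"
proof (cases "d constant_on unit_disc")
  case True
  then show ?thesis using d(2) z by (auto simp: constant_on_def)
next
  case False
  obtain g r n where g: "0 < n" "0 < r" "ball 0 r \<subseteq> unit_disc" "g holomorphic_on ball 0 r"
     "\<And>w. w \<in> ball 0 r \<Longrightarrow> d w = (w - 0) ^ n * g w" "\<And>w. w \<in> ball 0 r \<Longrightarrow> g w \<noteq> 0"
    by (rule holomorphic_factor_zero_nonconstant[OF d(1) _ _ _ d(2) False]) auto
  define G where "G w = (1 - \<alpha> + \<alpha> * of_nat n) * g w + \<alpha> * w * deriv g w" for w
  have G0: "G w = 0" if w: "w \<in> ball 0 r" "w \<noteq> 0" for w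
  proof -
    have dg: "(g has_field_derivative deriv g w) (at w)"
      using g w by (intro holomorphic_derivI[of g "ball 0 r"]) auto
    have "((\<lambda>w. w ^ n * g w) has_field_derivative (w ^ n * deriv g w + of_nat n * w ^ (n - 1) * g w)) (at w)"
      by (auto intro!: derivative_eq_intros dg)
    then have "(d has_field_derivative (w ^ n * deriv g w + of_nat n * w ^ (n - 1) * g w)) (at w)"
      by (rule has_field_derivative_transform_within_open[of _ _ _ "ball 0 r"]) (use w g(5) in auto)
    then have dd: "deriv d w = w ^ n * deriv g w + of_nat n * w ^ (n - 1) * g w"
      by (rule DERIV_imp_deriv)
    have "w * w ^ (n - 1) = w ^ n"
      using g(1) by (metis power_eq_if not_gr0)
    then have "(1 - \<alpha>) * d w + \<alpha> * w * deriv d w = w ^ n * G w"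
      using w(1) g(5)[of w] unfolding dd G_def by (simp add: algebra_simps)
    then show ?thesis using eq[of w] w g(3) by auto
  qed
  have "continuous_on (ball 0 r) G"
    unfolding G_def using g(4)
    by (intro continuous_intros holomorphic_on_imp_continuous_on holomorphic_deriv) auto
  then have "isCont G 0"
    using g(2) by (simp add: continuous_on_eq_continuous_at)
  then have "(G \<longlongrightarrow> G 0) (at 0)"
    by (simp add: isCont_def)
  moreover have "(G \<longlongrightarrow> 0) (at 0)"
    by (rule tendsto_eventually) (use G0 g(2) in \<open>auto simp: eventually_at dist_commute intro!: exI[of _ r]\<close>)
  ultimately have "G 0 = 0"
    using tendsto_unique trivial_limit_at by blast
  then have "1 + \<alpha> * (of_nat n - 1) = 0"
    using g(6)[of 0] g(2) by (simp add: G_def) (simp add: algebra_simps)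
  then have "Re (1 + \<alpha> * (of_nat n - 1)) = 0"
    by simp
  then have "1 + Re \<alpha> * (real n - 1) = 0"
    by simp
  moreover have "Re \<alpha> * (real n - 1) \<ge> 0"
    using g(1) \<alpha> by simp
  ultimately show ?thesis by linarith
qed

section \<open>The denominator of the extremal derivatives\<close>

text \<open>
  The denominator of \<open>half_plane_map \<beta> (disc_aut (c * z) lam * z)\<close> as a function of \<open>z\<close>. If
  \<open>|c| = 1\<close> and \<open>|lam| < 1\<close>, both of its zeros lie on the unit circle.
\<close>

definition extremal_den :: "complex \<Rightarrow> complex \<Rightarrow> complex \<Rightarrow> complex" where
  "extremal_den c lam z = 1 + (cnj lam * c - lam) * z - c * z\<^sup>2"

text \<open>
  With \<open>D = extremal_den c lam\<close> one has \<open>D - z D' = 1 + c z\<^sup>2\<close>. The statement therefore says that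
  \<open>z D' / D\<close> has real part below \<open>1\<close>, which yields starlikeness of a primitive of \<open>z\<^sup>2 / D\<^sup>2\<close>. Since
  \<open>c\<close> times the conjugate of the linear coefficient of \<open>D\<close> is minus that coefficient, the real part
  factors with \<open>1 - |z|\<^sup>2\<close>.
\<close>

lemma extremal_den_mult_pos:
  assumes c: "norm c = 1" and lam: "lam \<in> unit_disc" and z: "z \<in> unit_disc"
  shows "Re ((1 + c * z\<^sup>2) * cnj (extremal_den c lam z)) > 0"
proof -
  define a where "a = cnj lam * c - lam"
  have cc: "c * cnj c = 1"
    using c by (simp add: complex_norm_square[symmetric])
  have ca: "c * cnj a = - a"
    using cc by (simp add: a_def algebra_simps)
  define u where "u = a * z"
  define v where "v = c * z\<^sup>2"
  have vu: "v * cnj u = - u * of_real ((norm z)\<^sup>2)"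
  proof -
    have "v * cnj u = (c * cnj a) * z * (z * cnj z)"
      by (simp add: u_def v_def power2_eq_square algebra_simps)
    also have "\<dots> = (- a) * z * of_real ((norm z)\<^sup>2)"
      unfolding ca complex_norm_square[of z] by simp
    finally show ?thesis by (simp add: u_def)
  qed
  have nv: "norm v = (norm z)\<^sup>2"
    using c by (simp add: v_def norm_mult norm_power)
  have vv: "v * cnj v = of_real ((norm z)^4)"
    using nv by (simp add: complex_norm_square[symmetric] power_mult[symmetric])
  have "(1 + c * z\<^sup>2) * cnj (extremal_den c lam z) = (1 + v) * (1 + cnj u - cnj v)"
    by (simp add: extremal_den_def u_def v_def a_def)
  also have "\<dots> = 1 + cnj u - cnj v + v + v * cnj u - v * cnj v"
    by (simp add: algebra_simps)
  also have "Re \<dots> = 1 + Re u - Re u * (norm z)\<^sup>2 - (norm z)^4"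
    unfolding vu vv by simp
  also have "\<dots> = (1 - (norm z)\<^sup>2) * (1 + (norm z)\<^sup>2 + Re u)"
    by (simp add: algebra_simps power2_eq_square power4_eq_xxxx)
  finally have eq: "Re ((1 + c * z\<^sup>2) * cnj (extremal_den c lam z)) = (1 - (norm z)\<^sup>2) * (1 + (norm z)\<^sup>2 + Re u)" .
  have "norm a \<le> 2 * norm lam"
    unfolding a_def using norm_triangle_ineq4[of "cnj lam * c" lam] c by (simp add: norm_mult)
  then have "norm u \<le> 2 * norm lam * norm z"
    by (simp add: u_def norm_mult mult_right_mono)
  then have "Re u \<ge> - (2 * norm lam * norm z)"
    using abs_Re_le_cmod[of u] by linarith
  moreover have "1 + (norm z)\<^sup>2 - 2 * norm lam * norm z > 0"
  proof (cases "z = 0")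
    case False
    have "1 + (norm z)\<^sup>2 - 2 * norm lam * norm z = (1 - norm z)\<^sup>2 + 2 * norm z * (1 - norm lam)"
      by (simp add: power2_eq_square algebra_simps)
    moreover have "2 * norm z * (1 - norm lam) > 0"
      using False lam by simp
    ultimately show ?thesis using zero_le_power2[of "1 - norm z"] by linarith
  qed simp
  moreover have "1 - (norm z)\<^sup>2 > 0"
    using z by (simp add: power_less_one_iff abs_square_less_1)
  ultimately show ?thesis
    unfolding eq by (intro mult_pos_pos) auto
qed

lemma extremal_den_nonzero:
  assumes "norm c = 1" "lam \<in> unit_disc" "z \<in> unit_disc"
  shows "extremal_den c lam z \<noteq> 0"
  using extremal_den_mult_pos[OF assms] by auto

lemma Re_divide_pos_iff: "Re (a / b) > 0 \<longleftrightarrow> Re (a * cnj b) > 0"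
proof (cases "b = 0")
  case False
  then have "(norm b)\<^sup>2 > 0" by simp
  moreover have "Re (a / b) = Re (a * cnj b) / (norm b)\<^sup>2"
    by (simp add: Re_divide cmod_power2)
  ultimately show ?thesis by (metis zero_less_divide_iff order_less_asym)
qed simp

section \<open>Comparison of derivatives\<close>

lemma norm_diff_cnj_less:
  assumes "norm z < 1" "norm lam < 1"
  shows "norm (cnj lam - z) < norm (1 - lam * z)"
proof -
  have "(norm (1 - lam * z))\<^sup>2 - (norm (cnj lam - z))\<^sup>2 = (1 - (norm lam)\<^sup>2) * (1 - (norm z)\<^sup>2)"
    unfolding cmod_power2 by (simp add: power2_eq_square algebra_simps)
  moreover have "\<dots> > 0"
    using assms by (intro mult_pos_pos) (simp_all add: abs_square_less_1)
  ultimately have "(norm (cnj lam - z))\<^sup>2 < (norm (1 - lam * z))\<^sup>2"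
    by linarith
  then show ?thesis
    by (rule power2_less_imp_less) simp
qed

text \<open>
  The Moebius map \<open>x \<mapsto> (1 - x) (1 + k) / (1 + k x)\<close> sends \<open>1\<close> to \<open>0\<close> with derivative \<open>-1\<close>, so the image of
  the closed unit disc is a disc touching the imaginary axis at \<open>0\<close> from the right. The proof rests on
  an explicit expression of the real part as a sum of two nonnegative terms.
\<close>

lemma Re_moebius_pos:
  assumes k: "norm k < 1" and x: "norm x \<le> 1" "x \<noteq> 1"
  shows "Re ((1 - x) * (1 + k) / (1 + k * x)) > 0"
proof -
  have "Re ((1 - x) * (1 + k) * cnj (1 + k * x))
      = (1 - (norm k)\<^sup>2) * (norm (1 - x))\<^sup>2 / 2 + (1 - (norm x)\<^sup>2) * (norm (1 + k))\<^sup>2 / 2"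
    unfolding cmod_power2 by (simp add: power2_eq_square field_simps)
  moreover have "(1 - (norm k)\<^sup>2) * (norm (1 - x))\<^sup>2 > 0"
    using k x by (simp add: abs_square_less_1)
  moreover have "(1 - (norm x)\<^sup>2) * (norm (1 + k))\<^sup>2 \<ge> 0"
    using x by (simp add: abs_square_le_1)
  ultimately show ?thesis
    unfolding Re_divide_pos_iff by linarith
qed

text \<open>
  Up to a positive factor, the quotient of the difference of two derivatives (constant parameter \<open>c\<close>
  against parameter \<open>\<psi>\<close>) by the outward normal \<open>c z\<^sup>2 / (extremal_den c lam z)\<^sup>2\<close>; see
  \<open>extremal_diff\<close>.
\<close>

definition kernel_ratio :: "complex \<Rightarrow> complex \<Rightarrow> (complex \<Rightarrow> complex) \<Rightarrow> complex \<Rightarrow> complex" where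
  "kernel_ratio c lam \<psi> z = (1 - cnj c * \<psi> z) * extremal_den c lam z /
     (1 - lam * z + z * \<psi> z * (cnj lam - z))"

lemma weighted_denominator_nonzero:
  assumes "lam \<in> unit_disc" "z \<in> unit_disc" "norm w \<le> 1"
  shows "1 - lam * z + w * (cnj lam - z) \<noteq> 0"
proof
  assume "1 - lam * z + w * (cnj lam - z) = 0"
  then have "norm (1 - lam * z) = norm w * norm (cnj lam - z)"
    by (metis add_eq_0_iff2 norm_minus_cancel norm_mult)
  also have "\<dots> \<le> norm (cnj lam - z)"
    using assms by (simp add: mult_left_le_one_le)
  finally show False using norm_diff_cnj_less[of z lam] assms by simp
qed

text \<open>
  For fixed \<open>z\<close> this is the map of \<open>Re_moebius_pos\<close> in the variable \<open>x = cnj c * \<psi> z\<close>, with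
  \<open>k = c z (cnj lam - z) / (1 - lam z)\<close>.
\<close>

lemma kernel_ratio_pos:
  assumes c: "norm c = 1" and lam: "lam \<in> unit_disc" and z: "z \<in> unit_disc"
    and \<psi>: "norm (\<psi> z) \<le> 1" "\<psi> z \<noteq> c"
  shows "Re (kernel_ratio c lam \<psi> z) > 0"
proof -
  have cc: "c * cnj c = 1"
    using c by (simp add: complex_norm_square[symmetric])
  define x where "x = cnj c * \<psi> z"
  define A where "A = 1 - lam * z"
  define k where "k = c * z * (cnj lam - z) / A"
  have A0: "A \<noteq> 0" and kA: "norm (cnj lam - z) < norm A"
    using norm_diff_cnj_less[of z lam] lam z by (auto simp: A_def)
  have cx: "c * x = \<psi> z"
    using cc by (simp add: x_def mult.assoc[symmetric])
  have "norm z * norm (cnj lam - z) < norm A"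
    using kA z by (intro order.strict_trans1[OF _ kA] mult_left_le_one_le) auto
  then have k: "norm k < 1"
    using A0 c by (simp add: k_def norm_divide norm_mult divide_less_eq_1)
  have "x \<noteq> 1" using cx \<psi>(2) by auto
  moreover have "norm x \<le> 1" using c \<psi>(1) by (simp add: x_def norm_mult)
  ultimately have "Re ((1 - x) * (1 + k) / (1 + k * x)) > 0"
    using Re_moebius_pos k by blast
  moreover have "(1 - x) * (1 + k) / (1 + k * x) = (1 - x) * (A * (1 + k)) / (A * (1 + k * x))"
    using A0 by simp
  moreover have "A * (1 + k) = extremal_den c lam z"
    using A0 by (simp add: k_def extremal_den_def A_def field_simps power2_eq_square)
  moreover have "A * (1 + k * x) = 1 - lam * z + z * \<psi> z * (cnj lam - z)"
  proof -
    have "A * (1 + k * x) = A + (c * x) * z * (cnj lam - z)"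
      using A0 by (simp add: k_def field_simps)
    then show ?thesis unfolding cx by (simp add: A_def algebra_simps)
  qed
  ultimately show ?thesis
    unfolding kernel_ratio_def x_def by simp
qed

lemma two_one_minus_nonzero:
  assumes "\<beta> < 1"
  shows "2 * (1 - complex_of_real \<beta>) \<noteq> 0"
  using assms
  by (metis mult_eq_0_iff of_real_1 of_real_eq_iff order_less_irrefl right_minus_eq zero_neq_numeral)

lemma half_plane_map_alt:
  assumes "w \<noteq> 1"
  shows "half_plane_map \<beta> w = (2 * of_real \<beta> - 1) + 2 * (1 - of_real \<beta>) / (1 - w)"
  using assms by (simp add: half_plane_map_def field_simps)

lemma one_plus_cnj_mult_nonzero:
  assumes "norm lam < 1" "norm w \<le> 1"
  shows "1 + cnj lam * w \<noteq> 0"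
proof
  assume "1 + cnj lam * w = 0"
  then have "norm lam * norm w = 1"
    by (metis add_eq_0_iff complex_mod_cnj norm_minus_cancel norm_mult norm_one)
  moreover have "norm lam * norm w \<le> norm lam" using assms by (simp add: mult_left_le)
  ultimately show False using assms by simp
qed

lemma half_plane_map_disc_aut:
  assumes lam: "lam \<in> unit_disc" and z: "z \<in> unit_disc" and w: "norm w \<le> 1"
  shows "half_plane_map \<beta> (disc_aut w lam * z) =
    (2 * of_real \<beta> - 1) + 2 * (1 - of_real \<beta>) * (1 + cnj lam * w) / (1 - lam * z + w * (cnj lam - z))"
proof -
  have 1: "1 + cnj lam * w \<noteq> 0"
    using one_plus_cnj_mult_nonzero lam w by simp
  have 2: "1 - disc_aut w lam * z = (1 - lam * z + w * (cnj lam - z)) / (1 + cnj lam * w)"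
    using 1 by (simp add: disc_aut_def field_simps)
  then have "disc_aut w lam * z \<noteq> 1"
    using weighted_denominator_nonzero[OF lam z w] 1 by auto
  then show ?thesis
    unfolding half_plane_map_alt[OF \<open>disc_aut w lam * z \<noteq> 1\<close>] 2 by simp
qed

text \<open>
  For fixed \<open>z\<close> the values of \<open>half_plane_map \<beta> (disc_aut w lam * z)\<close> with \<open>|w| \<le> |z|\<close> fill a disc, and
  \<open>w = c z\<close> gives a point of its boundary circle. The difference to another value is written as a
  multiple of the outward normal at that point, which is \<open>c z\<^sup>2 / (extremal_den c lam z)\<^sup>2\<close> up to a positive
  factor.
\<close>

lemma extremal_diff:
  assumes c: "norm c = 1" and lam: "lam \<in> unit_disc" and z: "z \<in> unit_disc" and \<psi>: "norm (\<psi> z) \<le> 1"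
  shows "half_plane_map \<beta> (disc_aut (c * z) lam * z) - half_plane_map \<beta> (disc_aut (z * \<psi> z) lam * z)
    = 2 * (1 - of_real \<beta>) * (1 - cnj lam * lam) * c * z\<^sup>2 * (kernel_ratio c lam \<psi> z / (extremal_den c lam z)\<^sup>2)"
proof -
  have cc: "c * cnj c = 1"
    using c by (simp add: complex_norm_square[symmetric])
  define E where "E = 1 - lam * z + z * \<psi> z * (cnj lam - z)"
  define D where "D = extremal_den c lam z"
  have wc: "norm (c * z) \<le> 1" using c z by (simp add: norm_mult)
  have w: "norm (z * \<psi> z) \<le> 1" using z \<psi> by (simp add: norm_mult mult_le_one)
  have E: "E \<noteq> 0" unfolding E_def by (rule weighted_denominator_nonzero[OF lam z w])
  have DE: "1 - lam * z + c * z * (cnj lam - z) = D"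
    by (simp add: D_def extremal_den_def algebra_simps power2_eq_square)
  have D: "D \<noteq> 0" unfolding D_def using extremal_den_nonzero c lam z by blast
  have "(1 + cnj lam * (c * z)) / D - (1 + cnj lam * (z * \<psi> z)) / E
      = ((1 + cnj lam * (c * z)) * E - (1 + cnj lam * (z * \<psi> z)) * D) / (D * E)"
    using D E by (simp add: field_simps)
  also have "(1 + cnj lam * (c * z)) * E - (1 + cnj lam * (z * \<psi> z)) * D = (1 - cnj lam * lam) * z\<^sup>2 * (c - \<psi> z)"
    unfolding E_def DE[symmetric] by (simp add: algebra_simps power2_eq_square)
  also have "c - \<psi> z = c * (1 - cnj c * \<psi> z)"
    using cc by (simp add: right_diff_distrib mult.assoc[symmetric])
  also have "(1 - cnj lam * lam) * z\<^sup>2 * (c * (1 - cnj c * \<psi> z)) / (D * E)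
     = (1 - cnj lam * lam) * c * z\<^sup>2 * (kernel_ratio c lam \<psi> z / D\<^sup>2)"
    unfolding kernel_ratio_def E_def[symmetric] D_def[symmetric]
    using D by (simp add: power2_eq_square ac_simps)
  finally have *: "(1 + cnj lam * (c * z)) / D - (1 + cnj lam * (z * \<psi> z)) / E
     = (1 - cnj lam * lam) * c * z\<^sup>2 * (kernel_ratio c lam \<psi> z / D\<^sup>2)" .
  have "half_plane_map \<beta> (disc_aut (c * z) lam * z) - half_plane_map \<beta> (disc_aut (z * \<psi> z) lam * z)
     = 2 * (1 - of_real \<beta>) * ((1 + cnj lam * (c * z)) / D - (1 + cnj lam * (z * \<psi> z)) / E)"
    unfolding half_plane_map_disc_aut[OF lam z wc] half_plane_map_disc_aut[OF lam z w] DE E_def[symmetric]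
    by (simp add: algebra_simps)
  also have "\<dots> = 2 * (1 - of_real \<beta>) * ((1 - cnj lam * lam) * c * z\<^sup>2 * (kernel_ratio c lam \<psi> z / D\<^sup>2))"
    unfolding * ..
  finally show ?thesis unfolding D_def by (simp only: mult.assoc)
qed

section \<open>A starlike comparison function and Libera's lemma\<close>

text \<open>
  The function \<open>K = z\<^sup>3 H\<close> is the primitive of \<open>z\<^sup>2 / D\<^sup>2\<close> vanishing at the origin, where
  \<open>D = extremal_den c lam\<close>, and \<open>H D\<^sup>2\<close> equals \<open>K / (z K')\<close>, so the last assertion is the starlikeness
  of \<open>K\<close>. Working with \<open>H\<close> instead of \<open>K\<close> removes the singularity of these quotients at \<open>0\<close>. The quotient
  \<open>S = H D\<^sup>2\<close> satisfies \<open>z S' + S Q = 1\<close> with \<open>Q = 1 + z K'' / K'\<close> of positive real part. At a touching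
  point \<open>z S'\<close> would be real and nonpositive while \<open>S\<close> is imaginary, so \<open>S Q = 1 - z S' > 0\<close> would
  force \<open>Q\<close> to be imaginary.
\<close>

lemma starlike_factor:
  assumes c: "norm c = 1" and lam: "lam \<in> unit_disc"
  obtains H where "H holomorphic_on unit_disc"
    "\<And>z. z \<in> unit_disc \<Longrightarrow> 3 * H z + z * deriv H z = 1 / (extremal_den c lam z)\<^sup>2"
    "\<And>z. z \<in> unit_disc \<Longrightarrow> Re (H z * (extremal_den c lam z)\<^sup>2) > 0"
proof -
  let ?D = "extremal_den c lam"
  note nz = extremal_den_nonzero[OF c lam]
  have holD: "?D holomorphic_on unit_disc"
    unfolding extremal_den_def by (intro holomorphic_intros)
  have "(\<lambda>z. 1 / (3 * (?D z)\<^sup>2)) holomorphic_on unit_disc"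
    using nz by (intro holomorphic_intros holD) auto
  then obtain H where H: "H holomorphic_on unit_disc"
      "\<And>z. z \<in> unit_disc \<Longrightarrow> H z + (1/3) * z * deriv H z = 1 / (3 * (?D z)\<^sup>2)"
    by (rule euler_equation_solvable[where c = "1/3"]) auto
  have eq: "3 * H z + z * deriv H z = 1 / (?D z)\<^sup>2" if "z \<in> unit_disc" for z
    using arg_cong[OF H(2)[OF that], of "\<lambda>x. 3 * x"] by (simp add: algebra_simps)
  define S where "S z = H z * (?D z)\<^sup>2" for z
  have holS: "S holomorphic_on unit_disc"
    unfolding S_def by (intro holomorphic_intros H holD)
  have touch: False if z: "z \<in> unit_disc" and S0: "Re (S z) = 0" and t: "z * deriv S z = of_real t" "t \<le> 0" for z t
  proof -
    define Q where "Q = 1 + 2 * ((1 + c * z\<^sup>2) / ?D z)"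
    have Q: "Re Q > 0"
    proof -
      have "Re ((1 + c * z\<^sup>2) / ?D z) > 0"
        unfolding Re_divide_pos_iff by (rule extremal_den_mult_pos[OF c lam z])
      moreover have "Re Q = 1 + 2 * Re ((1 + c * z\<^sup>2) / ?D z)"
        unfolding Q_def by (simp del: times_divide_eq_right)
      ultimately show ?thesis by linarith
    qed
    \<comment> \<open>\<open>Q\<close> equals \<open>3 - 2 z D' / D\<close>, where \<open>D'\<close> is the derivative of the denominator.\<close>
    define D' where "D' = (cnj lam * c - lam) - 2 * c * z"
    have "(H has_field_derivative deriv H z) (at z)"
      using H(1) z by (intro holomorphic_derivI[of H unit_disc]) auto
    moreover have D': "(?D has_field_derivative D') (at z)"
      unfolding extremal_den_def D'_def by (auto intro!: derivative_eq_intros)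
    ultimately have "(S has_field_derivative (deriv H z * (?D z)\<^sup>2 + 2 * H z * ?D z * D')) (at z)"
      unfolding S_def by (auto intro!: derivative_eq_intros)
    then have dS: "deriv S z = deriv H z * (?D z)\<^sup>2 + 2 * H z * ?D z * D'"
      by (rule DERIV_imp_deriv)
    have SQ: "S z * Q = 3 * S z - 2 * H z * ?D z * (z * D')"
    proof -
      have "S z * Q = S z + 2 * H z * ?D z * (1 + c * z\<^sup>2)"
        using nz[OF z] by (simp add: S_def Q_def field_simps power2_eq_square)
      moreover have "1 + c * z\<^sup>2 = ?D z - z * D'"
        by (simp add: D'_def extremal_den_def algebra_simps power2_eq_square)
      ultimately have "S z * Q = S z + 2 * H z * ?D z * (?D z - z * D')"
        by simp
      then show ?thesis
        by (simp add: S_def algebra_simps power2_eq_square)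
    qed
    have "z * deriv S z + S z * Q = (3 * H z + z * deriv H z) * (?D z)\<^sup>2"
      unfolding SQ dS by (simp add: S_def algebra_simps)
    also have "\<dots> = 1"
      using nz[OF z] by (simp add: eq[OF z])
    finally have SQ1: "S z * Q = of_real (1 - t)"
      using t by (simp add: algebra_simps)
    have Si: "S z = \<i> * of_real (Im (S z))"
      using S0 by (simp add: complex_eq_iff)
    have "Im (S z) * Re Q = 0"
      using arg_cong[OF SQ1, of Im] by (subst (asm) Si) simp
    then have "Im (S z) = 0" using Q by simp
    then have "S z = 0" using Si by simp
    then show False using SQ1 t(2) by simp
  qed
  have "Re (S 0) > 0"
    using arg_cong[OF eq[of 0], of Re] by (simp add: S_def extremal_den_def)
  then have "Re (S z) > 0" if "z \<in> unit_disc" for z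
    by (intro Re_pos_by_touching_point[OF holS _ _ that]) (use touch in blast)+
  with H(1) eq show ?thesis
    by (intro that) (auto simp: S_def)
qed

text \<open>
  With \<open>K = z\<^sup>3 H\<close> and \<open>N = z\<^sup>3 T\<close> one has \<open>N' / K' = R\<close>. This is Libera's lemma: if \<open>K\<close> is starlike and
  \<open>N' / K'\<close> has positive real part, then so does \<open>N / K = T / H\<close>. Indeed \<open>P = T / H\<close> satisfies
  \<open>P + z P' S = R\<close> with \<open>S = K / (z K')\<close>; at a touching point the real part of the left side is
  \<open>z P' Re S \<le> 0\<close>.
\<close>

lemma libera_quotient:
  assumes c: "norm c = 1" and lam: "lam \<in> unit_disc"
    and H: "H holomorphic_on unit_disc"
      "\<And>z. z \<in> unit_disc \<Longrightarrow> 3 * H z + z * deriv H z = 1 / (extremal_den c lam z)\<^sup>2"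
      "\<And>z. z \<in> unit_disc \<Longrightarrow> Re (H z * (extremal_den c lam z)\<^sup>2) > 0"
    and R: "R holomorphic_on unit_disc" "\<And>z. z \<in> unit_disc \<Longrightarrow> Re (R z) > 0"
  obtains T where "T holomorphic_on unit_disc"
    "\<And>z. z \<in> unit_disc \<Longrightarrow> 3 * T z + z * deriv T z = R z / (extremal_den c lam z)\<^sup>2"
    "\<And>z. z \<in> unit_disc \<Longrightarrow> Re (T z / H z) > 0"
proof -
  let ?D = "extremal_den c lam"
  note nz = extremal_den_nonzero[OF c lam]
  have holD: "?D holomorphic_on unit_disc"
    unfolding extremal_den_def by (intro holomorphic_intros)
  have "(\<lambda>z. R z / (3 * (?D z)\<^sup>2)) holomorphic_on unit_disc"
    using nz by (intro holomorphic_intros holD R) auto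
  then obtain T where T: "T holomorphic_on unit_disc"
      "\<And>z. z \<in> unit_disc \<Longrightarrow> T z + (1/3) * z * deriv T z = R z / (3 * (?D z)\<^sup>2)"
    by (rule euler_equation_solvable[where c = "1/3"]) auto
  have eq: "3 * T z + z * deriv T z = R z / (?D z)\<^sup>2" if "z \<in> unit_disc" for z
    using arg_cong[OF T(2)[OF that], of "\<lambda>x. 3 * x"] by (simp add: algebra_simps)
  have H0: "H z \<noteq> 0" if "z \<in> unit_disc" for z
    using H(3)[OF that] by auto
  define P where "P z = T z / H z" for z
  have holP: "P holomorphic_on unit_disc"
    unfolding P_def by (intro holomorphic_intros T H H0)
  have PR: "P z + z * deriv P z * (H z * (?D z)\<^sup>2) = R z" if z: "z \<in> unit_disc" for z
  proof -
    have "(H has_field_derivative deriv H z) (at z)" "(T has_field_derivative deriv T z) (at z)"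
      using H(1) T(1) z by (auto intro!: holomorphic_derivI[of _ unit_disc])
    then have "(P has_field_derivative (deriv T z * H z - T z * deriv H z) / (H z * H z)) (at z)"
      unfolding P_def using H0[OF z] by (auto intro!: derivative_eq_intros)
    then have dP: "deriv P z = (deriv T z * H z - T z * deriv H z) / (H z * H z)"
      by (rule DERIV_imp_deriv)
    have D2: "(3 * H z + z * deriv H z) * (?D z)\<^sup>2 = 1" and D3: "(3 * T z + z * deriv T z) * (?D z)\<^sup>2 = R z"
      using nz[OF z] by (simp_all add: H(2)[OF z] eq[OF z])
    have "z * deriv P z * H z = z * deriv T z - P z * (z * deriv H z)"
      using H0[OF z] by (simp add: dP P_def field_simps)
    also have "\<dots> = (3 * T z + z * deriv T z) - P z * (3 * H z + z * deriv H z)"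
      using H0[OF z] by (simp add: P_def field_simps)
    finally have "z * deriv P z * (H z * (?D z)\<^sup>2) = ((3 * T z + z * deriv T z) - P z * (3 * H z + z * deriv H z)) * (?D z)\<^sup>2"
      by (metis mult.assoc)
    also have "\<dots> = R z - P z"
      unfolding left_diff_distrib D3 mult.assoc D2 by simp
    finally show ?thesis by simp
  qed
  have touch: False if z: "z \<in> unit_disc" and P0: "Re (P z) = 0" and t: "z * deriv P z = of_real t" "t \<le> 0" for z t
  proof -
    have "Re (R z) = t * Re (H z * (?D z)\<^sup>2)"
      unfolding PR[OF z, symmetric] t(1) using P0 by simp
    also have "\<dots> \<le> 0" using t(2) H(3)[OF z] by (simp add: mult_nonpos_nonneg)
    finally show False using R(2)[OF z] by simp
  qed
  have "Re (P 0) > 0"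
    using PR[of 0] R(2)[of 0] by simp
  then have "Re (P z) > 0" if "z \<in> unit_disc" for z
    by (intro Re_pos_by_touching_point[OF holP _ _ that]) (use touch in blast)+
  with T(1) eq show ?thesis
    by (intro that) (auto simp: P_def)
qed

section \<open>The supporting half plane\<close>

lemma field_derivative_eq_imp_eq:
  assumes "\<And>z. z \<in> unit_disc \<Longrightarrow> (f has_field_derivative h z) (at z)"
    and "\<And>z. z \<in> unit_disc \<Longrightarrow> (g has_field_derivative h z) (at z)"
    and "f 0 = g 0" and "z \<in> unit_disc"
  shows "f z = (g z :: complex)"
proof -
  have "\<exists>k. \<forall>z\<in>unit_disc. f z - g z = k"
  proof (rule has_field_derivative_zero_constant)
    show "((\<lambda>z. f z - g z) has_field_derivative 0) (at z within unit_disc)" if "z \<in> unit_disc" for z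
      using DERIV_diff[OF assms(1,2)[OF that]] by (simp add: has_field_derivative_at_within)
  qed simp
  then obtain k where k: "\<forall>z\<in>unit_disc. f z - g z = k" ..
  moreover have "k = 0" using k[rule_format, of 0] assms(3) by simp
  ultimately show ?thesis using assms(4) by auto
qed

lemma norm_le_one_attained_imp_constant:
  assumes "\<psi> holomorphic_on unit_disc" "\<And>z. z \<in> unit_disc \<Longrightarrow> norm (\<psi> z) \<le> 1"
    and "w \<in> unit_disc" "norm (\<psi> w) = 1" "z \<in> unit_disc"
  shows "\<psi> z = \<psi> w"
proof -
  have "\<psi> constant_on unit_disc"
    by (rule maximum_modulus_principle[where U = unit_disc and \<xi> = w]) (use assms in auto)
  then show ?thesis using assms(3,5) by (auto simp: constant_on_def)
qed

text \<open>
  Here \<open>p\<close> and \<open>q\<close> play the roles of \<open>alpha_op \<alpha> f\<close> for a competitor \<open>f\<close> and for the extremal function.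
  The direction \<open>\<nu> = c z0\<^sup>3 H(z0)\<close> depends only on \<open>c\<close>, \<open>lam\<close> and \<open>z0\<close>, and \<open>(q z0 - p z0) / \<nu>\<close> is a positive
  multiple of \<open>T z0 / H z0\<close> in Libera's lemma. The strict inequality for a single point where \<open>\<psi> \<noteq> c\<close>
  suffices, since by the maximum principle \<open>\<psi>\<close> then avoids \<open>c\<close> everywhere.
\<close>

lemma extremal_supports:
  assumes c: "norm c = 1" and lam: "lam \<in> unit_disc" and \<beta>: "\<beta> < 1" and z0: "z0 \<in> unit_disc - {0}"
  obtains \<nu> where
    "\<And>\<psi> p q w. \<lbrakk>\<psi> holomorphic_on unit_disc; \<And>z. z \<in> unit_disc \<Longrightarrow> norm (\<psi> z) \<le> 1;
        \<And>z. z \<in> unit_disc \<Longrightarrow> (p has_field_derivative half_plane_map \<beta> (disc_aut (z * \<psi> z) lam * z)) (at z);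
        \<And>z. z \<in> unit_disc \<Longrightarrow> (q has_field_derivative half_plane_map \<beta> (disc_aut (c * z) lam * z)) (at z);
        p 0 = q 0; w \<in> unit_disc; \<psi> w \<noteq> c\<rbrakk> \<Longrightarrow> Re ((q z0 - p z0) / \<nu>) > 0"
proof -
  let ?D = "extremal_den c lam"
  obtain H where H: "H holomorphic_on unit_disc"
    "\<And>z. z \<in> unit_disc \<Longrightarrow> 3 * H z + z * deriv H z = 1 / (?D z)\<^sup>2"
    "\<And>z. z \<in> unit_disc \<Longrightarrow> Re (H z * (?D z)\<^sup>2) > 0"
    using starlike_factor[OF c lam] by blast
  define \<nu> where "\<nu> = c * z0 ^ 3 * H z0"
  show ?thesis
  proof (rule that[of \<nu>])
    fix \<psi> p q w
    assume \<psi>: "\<psi> holomorphic_on unit_disc" "\<And>z. z \<in> unit_disc \<Longrightarrow> norm (\<psi> z) \<le> 1"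
      and p: "\<And>z. z \<in> unit_disc \<Longrightarrow> (p has_field_derivative half_plane_map \<beta> (disc_aut (z * \<psi> z) lam * z)) (at z)"
      and q: "\<And>z. z \<in> unit_disc \<Longrightarrow> (q has_field_derivative half_plane_map \<beta> (disc_aut (c * z) lam * z)) (at z)"
      and pq: "p 0 = q 0" and w: "w \<in> unit_disc" "\<psi> w \<noteq> c"
    have \<psi>c: "\<psi> z \<noteq> c" if "z \<in> unit_disc" for z
      using norm_le_one_attained_imp_constant[OF \<psi> that _ w(1)] c w(2) by auto
    have "norm (z * \<psi> z) \<le> 1" if "z \<in> unit_disc" for z
      using that \<psi>(2)[OF that] by (simp add: norm_mult mult_le_one)
    then have nz: "1 - lam * z + z * \<psi> z * (cnj lam - z) \<noteq> 0" if "z \<in> unit_disc" for z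
      using weighted_denominator_nonzero[OF lam that] that by blast
    have holR: "kernel_ratio c lam \<psi> holomorphic_on unit_disc"
      unfolding kernel_ratio_def[abs_def] extremal_den_def
      by (intro holomorphic_intros \<psi> nz)
    obtain T where T: "T holomorphic_on unit_disc"
       "\<And>z. z \<in> unit_disc \<Longrightarrow> 3 * T z + z * deriv T z = kernel_ratio c lam \<psi> z / (?D z)\<^sup>2"
       "\<And>z. z \<in> unit_disc \<Longrightarrow> Re (T z / H z) > 0"
      by (rule libera_quotient[OF c lam H holR]) (use kernel_ratio_pos[where \<psi> = \<psi>, OF c lam _ \<psi>(2) \<psi>c] in auto)
    define K where "K = 2 * (1 - of_real \<beta>) * (1 - cnj lam * lam) * c"
    have "q z0 - p z0 = K * z0 ^ 3 * T z0"
    proof (rule field_derivative_eq_imp_eq[where f = "\<lambda>z. q z - p z" and g = "\<lambda>z. K * z ^ 3 * T z"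
          and h = "\<lambda>z. K * z\<^sup>2 * (kernel_ratio c lam \<psi> z / (?D z)\<^sup>2)"])
      fix z assume z: "z \<in> unit_disc"
      show "((\<lambda>z. q z - p z) has_field_derivative K * z\<^sup>2 * (kernel_ratio c lam \<psi> z / (?D z)\<^sup>2)) (at z)"
        using DERIV_diff[OF q[OF z] p[OF z]] unfolding extremal_diff[where \<psi> = \<psi>, OF c lam z \<psi>(2)[OF z]]
        by (simp add: K_def)
      have "(T has_field_derivative deriv T z) (at z)"
        using T(1) z by (intro holomorphic_derivI[of T unit_disc]) auto
      then have "((\<lambda>z. K * z ^ 3 * T z) has_field_derivative K * z\<^sup>2 * (3 * T z + z * deriv T z)) (at z)"
        by (auto intro!: derivative_eq_intros simp: algebra_simps power2_eq_square power3_eq_cube)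
      then show "((\<lambda>z. K * z ^ 3 * T z) has_field_derivative K * z\<^sup>2 * (kernel_ratio c lam \<psi> z / (?D z)\<^sup>2)) (at z)"
        unfolding T(2)[OF z] .
    qed (use pq z0 in auto)
    moreover have "c \<noteq> 0" using c by auto
    ultimately have "(q z0 - p z0) / \<nu> = 2 * (1 - of_real \<beta>) * (1 - cnj lam * lam) * (T z0 / H z0)"
      using z0 by (simp add: \<nu>_def K_def)
    also have "\<dots> = of_real (2 * (1 - \<beta>) * (1 - (norm lam)\<^sup>2)) * (T z0 / H z0)"
      by (simp add: complex_norm_square mult.commute del: of_real_power)
    finally have "Re ((q z0 - p z0) / \<nu>) = 2 * (1 - \<beta>) * (1 - (norm lam)\<^sup>2) * Re (T z0 / H z0)"
      by (simp del: times_divide_eq_right)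
    moreover have "1 - (norm lam)\<^sup>2 > 0" using lam by (simp add: abs_square_less_1)
    ultimately show "Re ((q z0 - p z0) / \<nu>) > 0"
      using \<beta> T(3)[of z0] z0 by simp
  qed
qed

section \<open>Parametrization of the class by the unit ball\<close>

lemma schwarz_quotient:
  assumes \<omega>: "\<omega> holomorphic_on unit_disc" "\<omega> 0 = 0" "\<And>z. z \<in> unit_disc \<Longrightarrow> norm (\<omega> z) < 1"
  obtains \<phi> where "\<phi> holomorphic_on unit_disc" "\<And>z. z \<in> unit_disc \<Longrightarrow> norm (\<phi> z) \<le> 1"
    "\<And>z. \<omega> z = z * \<phi> z" "\<phi> 0 = deriv \<omega> 0"
proof
  let ?\<phi> = "\<lambda>z. if z = 0 then deriv \<omega> 0 else (\<omega> z - \<omega> 0) / (z - 0)"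
  show "?\<phi> holomorphic_on unit_disc"
    by (rule pole_lemma_open) (use \<omega> in auto)
  show "norm (?\<phi> z) \<le> 1" if "z \<in> unit_disc" for z
    using Schwarz_Lemma(1,2)[OF \<omega>(1,2), of z] \<omega> that by (auto simp: norm_divide divide_le_eq_1)
qed (use \<omega> in auto)

text \<open>
  Schwarz's lemma is used twice: first \<open>\<omega> = z \<phi>\<close> with \<open>\<phi> 0 = lam\<close>, and then the disc automorphism that
  moves \<open>lam\<close> to \<open>0\<close> turns \<open>\<phi>\<close> into a function \<open>\<kappa>\<close> with \<open>\<kappa> 0 = 0\<close>, so that \<open>\<kappa> = z \<psi>\<close>.
\<close>

lemma subordination_parameter:
  assumes lam: "lam \<in> unit_disc" and \<omega>: "\<omega> holomorphic_on unit_disc" "\<omega> 0 = 0"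
    "\<And>z. z \<in> unit_disc \<Longrightarrow> norm (\<omega> z) < 1" "deriv \<omega> 0 = lam"
  obtains \<psi> where "\<psi> holomorphic_on unit_disc" "\<And>z. z \<in> unit_disc \<Longrightarrow> norm (\<psi> z) \<le> 1"
    "\<And>z. z \<in> unit_disc \<Longrightarrow> \<omega> z = disc_aut (z * \<psi> z) lam * z"
proof -
  obtain \<phi> where \<phi>: "\<phi> holomorphic_on unit_disc" "\<And>z. z \<in> unit_disc \<Longrightarrow> norm (\<phi> z) \<le> 1"
    "\<And>z. \<omega> z = z * \<phi> z" "\<phi> 0 = lam"
    using schwarz_quotient[OF \<omega>(1-3)] \<omega>(4) by metis
  have \<phi>less: "norm (\<phi> z) < 1" if z: "z \<in> unit_disc" for z
  proof (rule ccontr)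
    assume "\<not> ?thesis"
    then have "norm (\<phi> z) = 1" using \<phi>(2)[OF z] by simp
    then have "\<phi> 0 = \<phi> z"
      using norm_le_one_attained_imp_constant[OF \<phi>(1,2) z] by simp
    then show False using \<open>norm (\<phi> z) = 1\<close> \<phi>(4) lam by simp
  qed
  define \<kappa> where "\<kappa> z = (\<phi> z - lam) / (1 - cnj lam * \<phi> z)" for z
  have less: "norm (\<phi> z - lam) < norm (1 - cnj lam * \<phi> z)" if "z \<in> unit_disc" for z
    using norm_diff_cnj_less[of "\<phi> z" "cnj lam"] \<phi>less[OF that] lam by (simp add: norm_minus_commute)
  have nz: "1 - cnj lam * \<phi> z \<noteq> 0" if "z \<in> unit_disc" for z
    using less[OF that] by auto
  have "\<kappa> holomorphic_on unit_disc"
    unfolding \<kappa>_def by (intro holomorphic_intros \<phi> nz)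
  moreover have "norm (\<kappa> z) < 1" if "z \<in> unit_disc" for z
    using less[OF that] by (simp add: \<kappa>_def norm_divide divide_less_eq_1)
  moreover have "\<kappa> 0 = 0" by (simp add: \<kappa>_def \<phi>)
  ultimately obtain \<psi> where \<psi>: "\<psi> holomorphic_on unit_disc" "\<And>z. z \<in> unit_disc \<Longrightarrow> norm (\<psi> z) \<le> 1"
    "\<And>z. \<kappa> z = z * \<psi> z"
    using schwarz_quotient[of \<kappa>] by metis
  have "cnj lam * lam \<noteq> 1"
    using lam by (metis abs_norm_cancel complex_mod_cnj mem_ball_0 norm_mult norm_one power2_eq_square abs_square_less_1 less_irrefl)
  then have l1: "1 - cnj lam * lam \<noteq> 0" by simp
  have "\<omega> z = disc_aut (z * \<psi> z) lam * z" if z: "z \<in> unit_disc" for z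
  proof -
    have "\<kappa> z + lam = (1 - cnj lam * lam) * \<phi> z / (1 - cnj lam * \<phi> z)"
      "1 + cnj lam * \<kappa> z = (1 - cnj lam * lam) / (1 - cnj lam * \<phi> z)"
      using nz[OF z] by (simp_all add: \<kappa>_def field_simps)
    then have "disc_aut (\<kappa> z) lam = \<phi> z"
      using nz[OF z] l1 by (simp add: disc_aut_def)
    then show ?thesis using \<phi>(3) \<psi>(3) by simp
  qed
  with \<psi> show ?thesis using that by blast
qed

lemma has_field_derivative_half_plane_map_0:
  "(half_plane_map \<beta> has_field_derivative 2 * (1 - of_real \<beta>)) (at 0)"
  unfolding half_plane_map_def[abs_def] by (auto intro!: derivative_eq_intros)

lemma has_field_derivative_alpha_op:
  assumes f: "f holomorphic_on unit_disc" and z: "z \<in> unit_disc"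
  shows "(alpha_op \<alpha> f has_field_derivative deriv f z + \<alpha> * z * deriv (deriv f) z) (at z)"
proof -
  have "(f has_field_derivative deriv f z) (at z)" "(deriv f has_field_derivative deriv (deriv f) z) (at z)"
    using f z by (auto intro!: holomorphic_derivI[of _ unit_disc] holomorphic_deriv)
  then show ?thesis
    unfolding alpha_op_def[abs_def] by (auto intro!: derivative_eq_intros simp: algebra_simps)
qed

text \<open>
  Both sides of the subordination identity are differentiated at the origin; this translates the
  prescribed value of \<open>f'' 0\<close> into a prescribed value of \<open>\<omega>' 0\<close>.
\<close>

lemma deriv_subordinate_at_0:
  assumes f: "f holomorphic_on unit_disc" and \<omega>: "\<omega> holomorphic_on unit_disc" "\<omega> 0 = 0"
    and eq: "\<And>z. z \<in> unit_disc \<Longrightarrow> deriv f z + \<alpha> * z * deriv (deriv f) z = half_plane_map \<beta> (\<omega> z)"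
  shows "(1 + \<alpha>) * deriv (deriv f) 0 = 2 * (1 - of_real \<beta>) * deriv \<omega> 0"
proof -
  have "(\<omega> has_field_derivative deriv \<omega> 0) (at 0)"
    using \<omega> by (intro holomorphic_derivI[of _ unit_disc]) auto
  then have "((half_plane_map \<beta> \<circ> \<omega>) has_field_derivative 2 * (1 - of_real \<beta>) * deriv \<omega> 0) (at 0)"
    using has_field_derivative_half_plane_map_0 \<omega>(2) by (intro DERIV_chain) auto
  then have 1: "((\<lambda>z. deriv f z + \<alpha> * z * deriv (deriv f) z) has_field_derivative 2 * (1 - of_real \<beta>) * deriv \<omega> 0) (at 0)"
    by (rule has_field_derivative_transform_within_open[of _ _ _ unit_disc]) (auto simp: eq)
  have "(deriv f has_field_derivative deriv (deriv f) 0) (at 0)"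
     "(deriv (deriv f) has_field_derivative deriv (deriv (deriv f)) 0) (at 0)"
    using f by (auto intro!: holomorphic_derivI[of _ unit_disc] holomorphic_deriv)
  then have "((\<lambda>z. deriv f z + \<alpha> * z * deriv (deriv f) z) has_field_derivative (1 + \<alpha>) * deriv (deriv f) 0) (at 0)"
    by (auto intro!: derivative_eq_intros simp: algebra_simps)
  from DERIV_unique[OF this 1] show ?thesis .
qed

lemma class_G_parameter:
  assumes \<alpha>: "Re \<alpha> > 0" and \<beta>: "\<beta> < 1" and lam: "lam \<in> unit_disc" and f: "f \<in> class_G \<alpha> \<beta> lam"
  obtains \<psi> where "\<psi> holomorphic_on unit_disc" "\<And>z. z \<in> unit_disc \<Longrightarrow> norm (\<psi> z) \<le> 1"
    "\<And>z. z \<in> unit_disc \<Longrightarrow>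
       (alpha_op \<alpha> f has_field_derivative half_plane_map \<beta> (disc_aut (z * \<psi> z) lam * z)) (at z)"
proof -
  have fh: "f holomorphic_on unit_disc" and f2: "deriv (deriv f) 0 = 2 * ((1 - of_real \<beta>) / (1 + \<alpha>)) * lam"
    using f by (auto simp: class_G_def class_F_def class_A_def)
  obtain \<omega> where \<omega>: "\<omega> holomorphic_on unit_disc" "\<omega> ` unit_disc \<subseteq> unit_disc" "\<omega> 0 = 0"
    "\<And>z. z \<in> unit_disc \<Longrightarrow> deriv f z + \<alpha> * z * deriv (deriv f) z = half_plane_map \<beta> (\<omega> z)"
    using f by (auto simp: class_G_def class_F_def subordinate_def)
  have "1 + \<alpha> \<noteq> 0" using \<alpha> by (auto simp: complex_eq_iff)
  then have "2 * (1 - of_real \<beta>) * deriv \<omega> 0 = 2 * (1 - of_real \<beta>) * lam"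
    using deriv_subordinate_at_0[OF fh \<omega>(1,3,4)] by (auto simp: f2)
  moreover have "2 * (1 - complex_of_real \<beta>) \<noteq> 0"
    by (rule two_one_minus_nonzero[OF \<beta>])
  ultimately have "deriv \<omega> 0 = lam" by simp
  then obtain \<psi> where "\<psi> holomorphic_on unit_disc" "\<And>z. z \<in> unit_disc \<Longrightarrow> norm (\<psi> z) \<le> 1"
    "\<And>z. z \<in> unit_disc \<Longrightarrow> \<omega> z = disc_aut (z * \<psi> z) lam * z"
    using subordination_parameter[OF lam \<omega>(1,3)] \<omega>(2) by (metis image_subset_iff mem_ball_0)
  then show ?thesis
    using has_field_derivative_alpha_op[OF fh] \<omega>(4) that by metis
qed

section \<open>Inverting the operator\<close>

text \<open>
  For \<open>F = z G\<close> the equation \<open>alpha_op \<alpha> F = p\<close> becomes the Euler equation \<open>G + \<alpha> z G' = p / z\<close>.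
\<close>

lemma alpha_op_surj:
  assumes p: "p holomorphic_on unit_disc" "p 0 = 0" "deriv p 0 = 1" and \<alpha>: "Re \<alpha> > 0"
  obtains F where "F \<in> class_A" "\<And>z. z \<in> unit_disc \<Longrightarrow> alpha_op \<alpha> F z = p z"
proof -
  define P where "P z = (if z = 0 then deriv p 0 else (p z - p 0) / (z - 0))" for z
  have "P holomorphic_on unit_disc"
    unfolding P_def[abs_def] by (rule pole_lemma_open) (use p in auto)
  then obtain G where G: "G holomorphic_on unit_disc"
      "\<And>z. z \<in> unit_disc \<Longrightarrow> G z + \<alpha> * z * deriv G z = P z"
    using euler_equation_solvable[of P \<alpha>] \<alpha> by (metis less_imp_le)
  define F where "F z = z * G z" for z
  have hol: "F holomorphic_on unit_disc"
    unfolding F_def by (intro holomorphic_intros G)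
  have dF: "deriv F z = G z + z * deriv G z" if "z \<in> unit_disc" for z
  proof (rule DERIV_imp_deriv)
    have "(G has_field_derivative deriv G z) (at z)"
      using G(1) that by (intro holomorphic_derivI[of _ unit_disc]) auto
    then show "(F has_field_derivative G z + z * deriv G z) (at z)"
      unfolding F_def by (auto intro!: derivative_eq_intros)
  qed
  show ?thesis
  proof
    show "F \<in> class_A"
      using hol dF[of 0] G(2)[of 0] p(3) by (simp add: class_A_def F_def P_def)
    show "alpha_op \<alpha> F z = p z" if z: "z \<in> unit_disc" for z
    proof -
      have "alpha_op \<alpha> F z = z * (G z + \<alpha> * z * deriv G z)"
        by (simp add: alpha_op_def dF[OF z] F_def algebra_simps)
      then show ?thesis using p(2) unfolding G(2)[OF z] by (simp add: P_def)
    qed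
  qed
qed

lemma alpha_op_inj:
  assumes f: "f holomorphic_on unit_disc" "f 0 = 0" and g: "g holomorphic_on unit_disc" "g 0 = 0"
    and \<alpha>: "Re \<alpha> > 0" and eq: "\<And>z. z \<in> unit_disc \<Longrightarrow> alpha_op \<alpha> f z = alpha_op \<alpha> g z"
    and z: "z \<in> unit_disc"
  shows "f z = g z"
proof -
  have dd: "deriv (\<lambda>z. f z - g z) z = deriv f z - deriv g z" if "z \<in> unit_disc" for z
    using f g that by (intro deriv_diff) (auto intro!: holomorphic_on_imp_differentiable_at[of _ unit_disc])
  have "f z - g z = 0"
  proof (rule euler_equation_unique[OF _ _ \<alpha> _ z])
    show "(\<lambda>z. f z - g z) holomorphic_on unit_disc" by (intro holomorphic_intros f g)
    show "(1 - \<alpha>) * (f z - g z) + \<alpha> * z * deriv (\<lambda>z. f z - g z) z = 0" if "z \<in> unit_disc" for z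
      using eq[OF that] by (simp add: dd[OF that] alpha_op_def algebra_simps)
  qed (use f g in auto)
  then show ?thesis by simp
qed

section \<open>Convexity of the variability region\<close>

lemma Re_half_plane_map:
  assumes \<beta>: "\<beta> < 1" and w: "norm w < 1"
  shows "Re (half_plane_map \<beta> w) > \<beta>"
proof -
  have w1: "w \<noteq> 1" using w by auto
  have "Re ((1 + w) * cnj (1 - w)) = 1 - (norm w)\<^sup>2"
    unfolding cmod_power2 by (simp add: power2_eq_square algebra_simps)
  then have "Re ((1 + w) / (1 - w)) > 0"
    unfolding Re_divide_pos_iff using w by (simp add: abs_square_less_1)
  moreover have "half_plane_map \<beta> w = of_real \<beta> + of_real (1 - \<beta>) * ((1 + w) / (1 - w))"
    using w1 by (simp add: half_plane_map_def field_simps)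
  ultimately show ?thesis
    using \<beta> by (simp del: times_divide_eq_right)
qed

text \<open>
  The half plane \<open>Re w > \<beta>\<close> is the image of the unit disc under the injective map \<open>half_plane_map \<beta>\<close>,
  so subordination can be replaced by a condition that is visibly preserved by convex combinations.
\<close>

lemma class_F_iff:
  assumes \<beta>: "\<beta> < 1"
  shows "f \<in> class_F \<alpha> \<beta> \<longleftrightarrow>
    f \<in> class_A \<and> (\<forall>z\<in>unit_disc. Re (deriv f z + \<alpha> * z * deriv (deriv f) z) > \<beta>)"
proof (intro iffI conjI)
  assume "f \<in> class_F \<alpha> \<beta>"
  then obtain \<omega> where "f \<in> class_A" "\<omega> ` unit_disc \<subseteq> unit_disc"
      "\<forall>z\<in>unit_disc. deriv f z + \<alpha> * z * deriv (deriv f) z = half_plane_map \<beta> (\<omega> z)"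
    by (auto simp: class_F_def subordinate_def)
  then show "f \<in> class_A" "\<forall>z\<in>unit_disc. Re (deriv f z + \<alpha> * z * deriv (deriv f) z) > \<beta>"
    using Re_half_plane_map[OF \<beta>] by (auto simp: image_subset_iff simp del: plus_complex.sel)
next
  assume *: "f \<in> class_A \<and> (\<forall>z\<in>unit_disc. Re (deriv f z + \<alpha> * z * deriv (deriv f) z) > \<beta>)"
  define g where "g z = deriv f z + \<alpha> * z * deriv (deriv f) z" for z
  have f: "f holomorphic_on unit_disc" "deriv f 0 = 1"
    using * by (auto simp: class_A_def)
  have g: "Re (g z) > \<beta>" if "z \<in> unit_disc" for z
    using * that by (auto simp: g_def)
  have holg: "g holomorphic_on unit_disc"
    unfolding g_def using f by (intro holomorphic_intros holomorphic_deriv) auto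
  have less: "norm (g z - 1) < norm (g z + 1 - 2 * of_real \<beta>)" if "z \<in> unit_disc" for z
  proof -
    have "(norm (g z + 1 - 2 * of_real \<beta>))\<^sup>2 - (norm (g z - 1))\<^sup>2 = 4 * (1 - \<beta>) * (Re (g z) - \<beta>)"
      unfolding cmod_power2 by (simp add: power2_eq_square algebra_simps)
    moreover have "\<dots> > 0" using \<beta> g[OF that] by simp
    ultimately have "(norm (g z - 1))\<^sup>2 < (norm (g z + 1 - 2 * of_real \<beta>))\<^sup>2" by linarith
    then show ?thesis by (rule power2_less_imp_less) simp
  qed
  have nz: "g z + 1 - 2 * of_real \<beta> \<noteq> 0" if "z \<in> unit_disc" for z
    using less[OF that] by auto
  \<comment> \<open>The inverse of the half plane map, applied to \<open>g\<close>.\<close>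
  define \<omega> where "\<omega> z = (g z - 1) / (g z + 1 - 2 * of_real \<beta>)" for z
  have "\<omega> holomorphic_on unit_disc"
    unfolding \<omega>_def by (intro holomorphic_intros holg nz)
  moreover have "\<omega> ` unit_disc \<subseteq> unit_disc"
    using less nz by (auto simp: \<omega>_def norm_divide divide_less_eq_1)
  moreover have "\<omega> 0 = 0" using f(2) by (simp add: \<omega>_def g_def)
  moreover have "g z = half_plane_map \<beta> (\<omega> z)" if "z \<in> unit_disc" for z
  proof -
    have b: "2 * (1 - complex_of_real \<beta>) \<noteq> 0"
      by (rule two_one_minus_nonzero[OF \<beta>])
    have "1 - \<omega> z = 2 * (1 - of_real \<beta>) / (g z + 1 - 2 * of_real \<beta>)"
      using nz[OF that] by (simp add: \<omega>_def field_simps)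
    moreover from this have "\<omega> z \<noteq> 1" using b nz[OF that] by auto
    ultimately show ?thesis
      using b by (simp add: half_plane_map_alt)
  qed
  ultimately have "subordinate g (half_plane_map \<beta>)"
    unfolding subordinate_def by blast
  then show "f \<in> class_F \<alpha> \<beta>"
    using * by (simp add: class_F_def g_def[abs_def])
qed

lemma deriv_linear_combination:
  assumes "f holomorphic_on unit_disc" "g holomorphic_on unit_disc" "z \<in> unit_disc"
  shows "deriv (\<lambda>z. u * f z + v * g z) z = u * deriv f z + v * deriv g z"
proof (rule DERIV_imp_deriv)
  have "(f has_field_derivative deriv f z) (at z)" "(g has_field_derivative deriv g z) (at z)"
    using assms by (auto intro!: holomorphic_derivI[of _ unit_disc])
  then show "((\<lambda>z. u * f z + v * g z) has_field_derivative u * deriv f z + v * deriv g z) (at z)"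
    by (auto intro!: derivative_eq_intros)
qed

lemma deriv2_linear_combination:
  assumes f: "f holomorphic_on unit_disc" and g: "g holomorphic_on unit_disc" and z: "z \<in> unit_disc"
  shows "deriv (deriv (\<lambda>z. u * f z + v * g z)) z = u * deriv (deriv f) z + v * deriv (deriv g) z"
proof -
  have "deriv (deriv (\<lambda>z. u * f z + v * g z)) z = deriv (\<lambda>z. u * deriv f z + v * deriv g z) z"
    by (rule complex_derivative_transform_within_open[of _ unit_disc])
       (use assms in \<open>auto intro!: holomorphic_intros holomorphic_deriv simp: deriv_linear_combination\<close>)
  also have "\<dots> = u * deriv (deriv f) z + v * deriv (deriv g) z"
    by (rule deriv_linear_combination) (use assms in \<open>auto intro!: holomorphic_deriv\<close>)
  finally show ?thesis .
qed

lemma convex_V_G: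
  assumes \<beta>: "\<beta> < 1" and z0: "z0 \<in> unit_disc"
  shows "convex (V_G \<alpha> \<beta> z0 lam)"
proof (rule convexI)
  fix x y and u v :: real
  assume "x \<in> V_G \<alpha> \<beta> z0 lam" "y \<in> V_G \<alpha> \<beta> z0 lam" and uv: "0 \<le> u" "0 \<le> v" "u + v = 1"
  then obtain f g where f: "f \<in> class_G \<alpha> \<beta> lam" "x = alpha_op \<alpha> f z0"
     and g: "g \<in> class_G \<alpha> \<beta> lam" "y = alpha_op \<alpha> g z0"
    by (auto simp: V_G_def)
  have fh: "f holomorphic_on unit_disc" "f 0 = 0" "deriv f 0 = 1"
      "\<And>z. z \<in> unit_disc \<Longrightarrow> Re (deriv f z + \<alpha> * z * deriv (deriv f) z) > \<beta>"
      "deriv (deriv f) 0 = 2 * ((1 - of_real \<beta>) / (1 + \<alpha>)) * lam"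
    and gh: "g holomorphic_on unit_disc" "g 0 = 0" "deriv g 0 = 1"
      "\<And>z. z \<in> unit_disc \<Longrightarrow> Re (deriv g z + \<alpha> * z * deriv (deriv g) z) > \<beta>"
      "deriv (deriv g) 0 = 2 * ((1 - of_real \<beta>) / (1 + \<alpha>)) * lam"
    using f g by (auto simp: class_G_def class_F_iff[OF \<beta>] class_A_def)
  define h where "h z = of_real u * f z + of_real v * g z" for z
  note d1 = deriv_linear_combination[OF fh(1) gh(1), of _ "of_real u" "of_real v", folded h_def]
  note d2 = deriv2_linear_combination[OF fh(1) gh(1), of _ "of_real u" "of_real v", folded h_def]
  have uvc: "complex_of_real u + complex_of_real v = 1"
    using uv(3) by (metis of_real_1 of_real_add)
  have hA: "h holomorphic_on unit_disc" "h 0 = 0" "deriv h 0 = 1"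
    unfolding h_def using fh gh uvc d1[of 0] by (auto intro!: holomorphic_intros simp: h_def)
  have h2: "deriv (deriv h) 0 = 2 * ((1 - of_real \<beta>) / (1 + \<alpha>)) * lam"
    using d2[of 0] unfolding fh(5) gh(5) distrib_right[symmetric] uvc by simp
  have hRe: "Re (deriv h z + \<alpha> * z * deriv (deriv h) z) > \<beta>" if z: "z \<in> unit_disc" for z
  proof -
    have "deriv h z + \<alpha> * z * deriv (deriv h) z
       = of_real u * (deriv f z + \<alpha> * z * deriv (deriv f) z) + of_real v * (deriv g z + \<alpha> * z * deriv (deriv g) z)"
      by (simp add: d1[OF z] d2[OF z] algebra_simps)
    moreover have "u * Re (deriv f z + \<alpha> * z * deriv (deriv f) z) + v * Re (deriv g z + \<alpha> * z * deriv (deriv g) z) > \<beta>"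
      using convex_bound_lt[of "- Re (deriv f z + \<alpha> * z * deriv (deriv f) z)" "- \<beta>"
        "- Re (deriv g z + \<alpha> * z * deriv (deriv g) z)" u v] fh(4)[OF z] gh(4)[OF z] uv
      by (simp del: plus_complex.sel times_complex.sel)
    ultimately show ?thesis by simp
  qed
  have "h \<in> class_G \<alpha> \<beta> lam"
    using hA h2 hRe by (auto simp: class_G_def class_F_iff[OF \<beta>] class_A_def)
  moreover have "u *\<^sub>R x + v *\<^sub>R y = alpha_op \<alpha> h z0"
    using z0 by (simp add: f(2) g(2) alpha_op_def d1 h_def scaleR_conv_of_real algebra_simps)
  ultimately show "u *\<^sub>R x + v *\<^sub>R y \<in> V_G \<alpha> \<beta> z0 lam"
    unfolding V_G_def by blast
qed

section \<open>Jordan curves on the frontier of a convex set\<close>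

text \<open>
  The inside of the curve lies in \<open>V\<close> by convexity, hence in its interior. A frontier point off the
  curve would lie outside the curve; the segment joining it to a point inside runs in the interior of
  \<open>V\<close> apart from that end point, so it would pass from the inside to the outside without
  meeting the curve.
\<close>

lemma frontier_convex_eq_Jordan_curve:
  fixes J :: "real \<Rightarrow> complex"
  assumes V: "convex V" and J: "simple_path J" "pathfinish J = pathstart J"
    and JV: "path_image J \<subseteq> V" and JF: "path_image J \<subseteq> frontier V"
  shows "frontier V = path_image J"
proof (intro equalityI JF subsetI)
  fix x assume x: "x \<in> frontier V"
  show "x \<in> path_image J"
  proof (rule ccontr)
    assume xJ: "x \<notin> path_image J"
    let ?I = "inside (path_image J)" and ?O = "outside (path_image J)"
    note JC = Jordan_inside_outside[OF J]
    have "?I \<subseteq> V"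
      using outside_subset_convex[OF V JV] JC by blast
    then have IV: "?I \<subseteq> interior V"
      using JC by (simp add: interior_maximal)
    obtain y where y: "y \<in> ?I" using JC by blast
    have xi: "x \<notin> interior V" and xc: "x \<in> closure V"
      using x by (auto simp: frontier_def)
    have seg: "open_segment y x \<subseteq> interior V"
      using in_interior_closure_convex_segment[OF V _ xc] y IV by blast
    have "closed_segment y x \<subseteq> interior V \<union> {x}"
      using seg y IV by (auto simp: open_segment_def)
    then have disj: "closed_segment y x \<inter> path_image J = {}"
      using JF xJ by (auto simp: frontier_def)
    have "x \<notin> ?I" using IV xi by blast
    then have "closed_segment y x \<inter> ?O \<noteq> {}"
      using JC xJ by (metis ComplI Int_iff UnE empty_iff ends_in_segment(2))
    moreover have "closed_segment y x \<inter> ?I \<noteq> {}" using y by auto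
    moreover have "closed_segment y x \<subseteq> ?I \<union> ?O" using JC disj by blast
    ultimately show False
      using connectedD[OF connected_segment(1)[of y x], of ?I ?O] JC by blast
  qed
qed

section \<open>The extremal primitives in closed form\<close>

definition extremal_primitive :: "real \<Rightarrow> complex \<Rightarrow> real \<Rightarrow> complex \<Rightarrow> complex" where
  "extremal_primitive \<beta> lam \<theta> z =
     (let e = cis (\<theta> / 2);
          b = Im (cnj lam * e);
          s = complex_of_real (sqrt (1 - b\<^sup>2));
          ib = \<i> * complex_of_real b
      in (2 * of_real \<beta> - 1) * z +
         (1 - of_real \<beta>) * cis (- \<theta> / 2) / s *
           ((1 + cnj lam * e * (- s + ib)) * Ln (1 + e * z / (s - ib)) -
            (1 + cnj lam * e * (s + ib)) * Ln (1 - e * z / (s + ib))))"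

lemma abs_Im_cnj_mult_cis:
  assumes "lam \<in> unit_disc"
  shows "\<bar>Im (cnj lam * cis x)\<bar> < 1"
  using abs_Im_le_cmod[of "cnj lam * cis x"] assms by (simp add: norm_mult del: times_complex.sel)

lemma norm_sqrt_ii:
  assumes "\<bar>b\<bar> < 1"
  shows "norm (complex_of_real (sqrt (1 - b\<^sup>2)) - \<i> * of_real b) = 1"
    "norm (complex_of_real (sqrt (1 - b\<^sup>2)) + \<i> * of_real b) = 1"
  using assms by (simp_all add: cmod_def abs_square_le_1)

text \<open>
  The principal logarithms in the closed form are evaluated within distance \<open>1\<close> of \<open>1\<close>, away from
  the branch cut.
\<close>

lemma one_plus_not_nonpos_Reals:
  fixes w :: complex
  assumes "norm w < 1"
  shows "1 + w \<notin> \<real>\<^sub>\<le>\<^sub>0" "1 - w \<notin> \<real>\<^sub>\<le>\<^sub>0"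
  using abs_Re_le_cmod[of w] assms by (auto simp: complex_nonpos_Reals_iff)

lemma extremal_primitive_0 [simp]: "extremal_primitive \<beta> lam \<theta> 0 = 0"
  by (simp add: extremal_primitive_def)

text \<open>
  Put \<open>u = e z\<close> with \<open>e = cis (\<theta> / 2)\<close>. Because \<open>2 i b e = cnj lam * cis \<theta> - lam\<close> and
  \<open>s\<^sup>2 + b\<^sup>2 = 1\<close>, the denominator factors as \<open>(s - i b + u) (s + i b - u)\<close>; the two logarithms come from the
  partial fraction decomposition.
\<close>

lemma extremal_primitive_deriv:
  assumes lam: "lam \<in> unit_disc" and z: "z \<in> unit_disc"
  shows "(extremal_primitive \<beta> lam \<theta> has_field_derivative
            half_plane_map \<beta> (disc_aut (cis \<theta> * z) lam * z)) (at z)"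
proof -
  define e where "e = cis (\<theta> / 2)"
  define b where "b = Im (cnj lam * e)"
  define s where "s = complex_of_real (sqrt (1 - b\<^sup>2))"
  define ib where "ib = \<i> * complex_of_real b"
  have b1: "\<bar>b\<bar> < 1" unfolding b_def e_def by (rule abs_Im_cnj_mult_cis[OF lam])
  have b2: "1 - b\<^sup>2 > 0" using b1 by (simp add: abs_square_less_1)
  have s0: "s \<noteq> 0" using b2 by (simp add: s_def)
  have "s * s = of_real (1 - b\<^sup>2)"
    using b2 unfolding s_def of_real_mult[symmetric] by simp
  also have "\<dots> = 1 + ib * ib"
    by (simp add: ib_def power2_eq_square algebra_simps)
  finally have s2: "s * s = 1 + ib * ib" .
  have n: "norm (s - ib) = 1" "norm (s + ib) = 1"
    unfolding s_def ib_def by (rule norm_sqrt_ii[OF b1])+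
  have nz: "s - ib \<noteq> 0" "s + ib \<noteq> 0" using n by auto
  have small: "norm (e * z / (s - ib)) < 1" "norm (e * z / (s + ib)) < 1"
    using z unfolding norm_divide norm_mult n by (simp_all add: e_def)
  note Lnd = one_plus_not_nonpos_Reals(1)[OF small(1)] one_plus_not_nonpos_Reals(2)[OF small(2)]
  have ee: "e * e = cis \<theta>" "cis (- \<theta> / 2) * e = 1" "norm e = 1"
    by (simp_all add: e_def cis_mult)
  have ecnj: "e * cnj e = 1" using ee(3) by (simp add: complex_norm_square[symmetric])
  define k where "k = cnj lam * e"
  have ibk: "2 * ib = k - cnj k"
    by (simp add: ib_def b_def k_def[symmetric] complex_eq_iff)
  have "2 * ib * e = cnj lam * (e * e) - lam * (e * cnj e)"
    unfolding ibk by (simp add: k_def algebra_simps)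
  then have ibe: "2 * ib * e = cnj lam * cis \<theta> - lam"
    unfolding ee ecnj by simp
  define D where "D = extremal_den (cis \<theta>) lam z"
  have D: "D = (s - ib + e * z) * (s + ib - e * z)"
  proof -
    have "(s - ib + e * z) * (s + ib - e * z) = s * s - ib * ib + (2 * ib * e) * z - (e * e) * (z * z)"
      by (simp add: algebra_simps)
    then show ?thesis
      unfolding s2 ibe ee D_def extremal_den_def by (simp add: power2_eq_square)
  qed
  have D0: "D \<noteq> 0" unfolding D_def by (rule extremal_den_nonzero) (use lam z in auto)
  then have nz2: "s - ib + e * z \<noteq> 0" "s + ib - e * z \<noteq> 0" using D by auto
  \<comment> \<open>The termwise derivative, before the partial fractions are recombined.\<close>
  define h where "h = (2 * of_real \<beta> - 1) + (1 - of_real \<beta>) * cis (- \<theta> / 2) / s *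
      ((1 + k * (- s + ib)) * ((e / (s - ib)) / (1 + e * z / (s - ib)))
        - (1 + k * (s + ib)) * ((- (e / (s + ib))) / (1 - e * z / (s + ib))))"
  have 1: "((\<lambda>z. (2 * of_real \<beta> - 1) * z + (1 - of_real \<beta>) * cis (- \<theta> / 2) / s *
      ((1 + k * (- s + ib)) * Ln (1 + e * z / (s - ib)) -
            (1 + k * (s + ib)) * Ln (1 - e * z / (s + ib)))) has_field_derivative h) (at z)"
  proof -
    have Ln: "((\<lambda>z. Ln (1 + a * z)) has_field_derivative a / (1 + a * z)) (at z)"
      if "1 + a * z \<notin> \<real>\<^sub>\<le>\<^sub>0" for a
      using that by (auto intro!: derivative_eq_intros simp: divide_inverse)
    have "((\<lambda>z. Ln (1 + e * z / (s - ib))) has_field_derivative (e / (s - ib)) / (1 + e * z / (s - ib))) (at z)"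
      using Ln[of "e / (s - ib)"] Lnd by simp
    moreover have "((\<lambda>z. Ln (1 - e * z / (s + ib))) has_field_derivative (- (e / (s + ib))) / (1 - e * z / (s + ib))) (at z)"
      using Ln[of "- (e / (s + ib))"] Lnd by simp
    ultimately show ?thesis
      unfolding h_def by (intro DERIV_add DERIV_cmult_Id DERIV_cmult DERIV_diff)
  qed
  have cancel: "(x / d) / (1 + x * z / d) = x / (d + x * z)" if "d \<noteq> 0" for x d
  proof -
    have "1 + x * z / d = (d + x * z) / d" using that by (simp add: field_simps)
    then show ?thesis using that by simp
  qed
  have 2: "(e / (s - ib)) / (1 + e * z / (s - ib)) = e / (s - ib + e * z)"
    by (rule cancel[OF nz(1)])
  have 3: "(- (e / (s + ib))) / (1 - e * z / (s + ib)) = - e / (s + ib - e * z)"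
    using cancel[OF nz(2), of "- e"] by simp
  have "(1 + k * (- s + ib)) * (e / (s - ib + e * z)) - (1 + k * (s + ib)) * (- e / (s + ib - e * z))
     = e * ((1 + k * (- s + ib)) * (s + ib - e * z) + (1 + k * (s + ib)) * (s - ib + e * z)) / D"
    unfolding D using nz2 by (simp add: field_simps)
  also have "(1 + k * (- s + ib)) * (s + ib - e * z) + (1 + k * (s + ib)) * (s - ib + e * z) = 2 * s * (1 + k * e * z)"
    by (simp add: algebra_simps)
  also have "k * e = cnj lam * cis \<theta>" unfolding k_def mult.assoc ee ..
  finally have "h = (2 * of_real \<beta> - 1) + (1 - of_real \<beta>) * cis (- \<theta> / 2) / s * (e * (2 * s * (1 + cnj lam * cis \<theta> * z)) / D)"
    unfolding h_def 2 3 by simp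
  also have "\<dots> = (2 * of_real \<beta> - 1) + 2 * (1 - of_real \<beta>) * (cis (- \<theta> / 2) * e) * (1 + cnj lam * cis \<theta> * z) / D"
  proof -
    have "B * m / s * (e * (2 * s * X) / D) = 2 * B * (m * e) * X / D" for B m X
      using s0 by simp
    then show ?thesis by (simp only:)
  qed
  also have "\<dots> = half_plane_map \<beta> (disc_aut (cis \<theta> * z) lam * z)"
  proof -
    have "1 - lam * z + cis \<theta> * z * (cnj lam - z) = D"
      by (simp add: D_def extremal_den_def algebra_simps power2_eq_square)
    then show ?thesis
      using half_plane_map_disc_aut[OF lam z, of "cis \<theta> * z" \<beta>] z unfolding ee
      by (simp add: norm_mult mult.assoc)
  qed
  finally have "h = half_plane_map \<beta> (disc_aut (cis \<theta> * z) lam * z)" .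
  moreover have "extremal_primitive \<beta> lam \<theta> = (\<lambda>z. (2 * of_real \<beta> - 1) * z + (1 - of_real \<beta>) * cis (- \<theta> / 2) / s *
      ((1 + k * (- s + ib)) * Ln (1 + e * z / (s - ib)) -
            (1 + k * (s + ib)) * Ln (1 - e * z / (s + ib))))"
    by (simp only: extremal_primitive_def[abs_def] Let_def e_def b_def s_def ib_def k_def)
  ultimately show ?thesis using 1 by simp
qed

lemma continuous_on_extremal_primitive:
  assumes lam: "lam \<in> unit_disc" and z: "z \<in> unit_disc"
  shows "continuous_on UNIV (\<lambda>\<theta>. extremal_primitive \<beta> lam \<theta> z)"
proof -
  define b where "b \<theta> = Im (cnj lam * cis (\<theta> / 2))" for \<theta>
  define s where "s \<theta> = complex_of_real (sqrt (1 - (b \<theta>)\<^sup>2))" for \<theta>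
  have b1: "\<bar>b \<theta>\<bar> < 1" for \<theta>
    unfolding b_def by (rule abs_Im_cnj_mult_cis[OF lam])
  have n: "norm (s \<theta> - \<i> * of_real (b \<theta>)) = 1" "norm (s \<theta> + \<i> * of_real (b \<theta>)) = 1" for \<theta>
    unfolding s_def by (rule norm_sqrt_ii[OF b1])+
  have nz: "s \<theta> - \<i> * of_real (b \<theta>) \<noteq> 0" "s \<theta> + \<i> * of_real (b \<theta>) \<noteq> 0" "s \<theta> \<noteq> 0" for \<theta>
    using n[of \<theta>] b1[of \<theta>] by (auto simp: s_def abs_square_eq_1)
  have Lnd: "1 + cis (\<theta> / 2) * z / (s \<theta> - \<i> * of_real (b \<theta>)) \<notin> \<real>\<^sub>\<le>\<^sub>0"
     "1 - cis (\<theta> / 2) * z / (s \<theta> + \<i> * of_real (b \<theta>)) \<notin> \<real>\<^sub>\<le>\<^sub>0" for \<theta>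
    using z by (auto intro!: one_plus_not_nonpos_Reals simp: norm_divide norm_mult n)
  have cb: "continuous_on UNIV b" unfolding b_def by (intro continuous_intros) auto
  have cs: "continuous_on UNIV s" unfolding s_def by (intro continuous_intros cb)
  show ?thesis
    unfolding extremal_primitive_def Let_def b_def[symmetric] s_def[symmetric]
    by (intro continuous_intros cb cs ballI nz Lnd) auto
qed

section \<open>The extremal functions\<close>

lemma disc_aut_less:
  assumes "lam \<in> unit_disc" "w \<in> unit_disc"
  shows "norm (disc_aut w lam) < 1"
proof -
  have "norm (w + lam) < norm (1 + cnj lam * w)"
    using norm_diff_cnj_less[of w "- cnj lam"] assms
    by (simp add: norm_minus_commute add.commute)
  then show ?thesis
    by (auto simp: disc_aut_def norm_divide divide_less_eq_1)
qed

text \<open>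
  The closed form is a primitive of the integrand, so it equals the defining integral, and the choice
  in \<open>F_fun\<close> is made from a nonempty set.
\<close>

lemma F_fun_primitive:
  assumes \<alpha>: "Re \<alpha> > 0" and lam: "lam \<in> unit_disc"
  shows "F_fun \<alpha> \<beta> (cis \<theta>) lam \<in> class_A"
    and "z \<in> unit_disc \<Longrightarrow> alpha_op \<alpha> (F_fun \<alpha> \<beta> (cis \<theta>) lam) z = extremal_primitive \<beta> lam \<theta> z"
proof -
  let ?L = "extremal_primitive \<beta> lam \<theta>"
  note der = extremal_primitive_deriv[OF lam, where \<beta> = \<beta> and \<theta> = \<theta>]
  have int: "contour_integral (linepath 0 z) (\<lambda>\<zeta>. half_plane_map \<beta> (disc_aut (cis \<theta> * \<zeta>) lam * \<zeta>)) = ?L z"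
    if z: "z \<in> unit_disc" for z
  proof -
    have "path_image (linepath 0 z) \<subseteq> unit_disc"
      using z by (simp add: closed_segment_subset)
    then have "((\<lambda>\<zeta>. half_plane_map \<beta> (disc_aut (cis \<theta> * \<zeta>) lam * \<zeta>)) has_contour_integral
        (?L (pathfinish (linepath 0 z)) - ?L (pathstart (linepath 0 z)))) (linepath 0 z)"
      by (intro contour_integral_primitive[of unit_disc])
         (simp_all only: valid_path_linepath has_field_derivative_at_within[OF der])
    then show ?thesis by (simp add: contour_integral_unique)
  qed
  have "?L holomorphic_on unit_disc"
    by (subst holomorphic_on_open) (blast intro: der)+
  moreover have "deriv ?L 0 = 1"
    using DERIV_imp_deriv[OF der[of 0]] by (simp add: half_plane_map_def)
  ultimately obtain F where "F \<in> class_A" "\<And>z. z \<in> unit_disc \<Longrightarrow> alpha_op \<alpha> F z = ?L z"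
    using alpha_op_surj[of ?L] \<alpha> by (metis extremal_primitive_0)
  moreover define Q where "Q F \<longleftrightarrow> F \<in> class_A \<and> (\<forall>z\<in>unit_disc. alpha_op \<alpha> F z =
      contour_integral (linepath 0 z) (\<lambda>\<zeta>. half_plane_map \<beta> (disc_aut (cis \<theta> * \<zeta>) lam * \<zeta>)))" for F
  ultimately have "Q F"
    using int by simp
  then have "Q (SOME F. Q F)" by (rule someI[of Q])
  moreover have "F_fun \<alpha> \<beta> (cis \<theta>) lam = (SOME F. Q F)"
    by (simp only: F_fun_def Q_def)
  ultimately have *: "Q (F_fun \<alpha> \<beta> (cis \<theta>) lam)" by simp
  show "F_fun \<alpha> \<beta> (cis \<theta>) lam \<in> class_A"
    and "z \<in> unit_disc \<Longrightarrow> alpha_op \<alpha> (F_fun \<alpha> \<beta> (cis \<theta>) lam) z = ?L z"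
    using * int by (auto simp: Q_def)
qed

lemma F_fun_in_class_G:
  assumes \<alpha>: "Re \<alpha> > 0" and lam: "lam \<in> unit_disc"
  shows "F_fun \<alpha> \<beta> (cis \<theta>) lam \<in> class_G \<alpha> \<beta> lam"
proof -
  let ?F = "F_fun \<alpha> \<beta> (cis \<theta>) lam"
  note FA = F_fun_primitive(1)[OF \<alpha> lam, of \<beta> \<theta>]
  then have Fh: "?F holomorphic_on unit_disc" by (simp add: class_A_def)
  define \<omega> where "\<omega> z = disc_aut (cis \<theta> * z) lam * z" for z
  have less: "norm (disc_aut (cis \<theta> * z) lam) < 1" if "z \<in> unit_disc" for z
    using disc_aut_less[OF lam] that by (simp add: norm_mult)
  have nz: "1 + cnj lam * (cis \<theta> * z) \<noteq> 0" if "z \<in> unit_disc" for z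
    using one_plus_cnj_mult_nonzero[of lam "cis \<theta> * z"] lam that by (simp add: norm_mult)
  have \<omega>: "\<omega> holomorphic_on unit_disc"
    unfolding \<omega>_def disc_aut_def by (intro holomorphic_intros nz)
  have \<omega>1: "norm (\<omega> z) < 1" if "z \<in> unit_disc" for z
  proof -
    have "norm (\<omega> z) \<le> norm z"
      using less[OF that] by (simp add: \<omega>_def norm_mult mult_left_le_one_le)
    then show ?thesis using that by simp
  qed
  have eq: "deriv ?F z + \<alpha> * z * deriv (deriv ?F) z = half_plane_map \<beta> (\<omega> z)" if z: "z \<in> unit_disc" for z
  proof (rule DERIV_unique)
    show "(alpha_op \<alpha> ?F has_field_derivative deriv ?F z + \<alpha> * z * deriv (deriv ?F) z) (at z)"
      by (rule has_field_derivative_alpha_op[OF Fh z])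
    show "(alpha_op \<alpha> ?F has_field_derivative half_plane_map \<beta> (\<omega> z)) (at z)"
      unfolding \<omega>_def
      by (rule has_field_derivative_transform_within_open[OF extremal_primitive_deriv[OF lam z], of unit_disc])
         (use z F_fun_primitive(2)[OF \<alpha> lam] in auto)
  qed
  have "\<omega> 0 = 0" by (simp add: \<omega>_def)
  have "(\<omega> has_field_derivative lam) (at 0)"
    unfolding \<omega>_def disc_aut_def by (auto intro!: derivative_eq_intros)
  then have "deriv \<omega> 0 = lam" by (rule DERIV_imp_deriv)
  then have "(1 + \<alpha>) * deriv (deriv ?F) 0 = 2 * (1 - of_real \<beta>) * lam"
    using deriv_subordinate_at_0[OF Fh \<omega> \<open>\<omega> 0 = 0\<close> eq] by simp
  moreover have "1 + \<alpha> \<noteq> 0" using \<alpha> by (auto simp: complex_eq_iff)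
  ultimately have "deriv (deriv ?F) 0 = 2 * ((1 - of_real \<beta>) / (1 + \<alpha>)) * lam"
    by (simp add: nonzero_eq_divide_eq mult.commute)
  moreover have "subordinate (\<lambda>z. deriv ?F z + \<alpha> * z * deriv (deriv ?F) z) (half_plane_map \<beta>)"
    unfolding subordinate_def using \<omega> \<omega>1 \<open>\<omega> 0 = 0\<close> eq by (intro exI[of _ \<omega>]) auto
  ultimately show ?thesis
    using FA by (simp add: class_G_def class_F_def)
qed

text \<open>
  The value of the extremal function at \<open>z0\<close> is an exposed point of the variability region, and no
  other member of the class attains it. The normal \<open>\<nu>\<close> is the one of \<open>extremal_supports\<close>.
\<close>

lemma extremal_exposed:
  assumes \<alpha>: "Re \<alpha> > 0" and \<beta>: "\<beta> < 1" and lam: "lam \<in> unit_disc" and z0: "z0 \<in> unit_disc - {0}"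
  obtains \<nu> where "\<And>f. f \<in> class_G \<alpha> \<beta> lam \<Longrightarrow>
    (\<forall>z\<in>unit_disc. f z = F_fun \<alpha> \<beta> (cis \<theta>) lam z) \<or>
      Re ((alpha_op \<alpha> (F_fun \<alpha> \<beta> (cis \<theta>) lam) z0 - alpha_op \<alpha> f z0) / \<nu>) > 0"
proof -
  let ?F = "F_fun \<alpha> \<beta> (cis \<theta>) lam" and ?L = "extremal_primitive \<beta> lam \<theta>"
  have FA: "?F \<in> class_A" and FL: "\<And>z. z \<in> unit_disc \<Longrightarrow> alpha_op \<alpha> ?F z = ?L z"
    using F_fun_primitive[OF \<alpha> lam] by auto
  obtain \<nu> where \<nu>:
    "\<And>\<psi> p q w. \<lbrakk>\<psi> holomorphic_on unit_disc; \<And>z. z \<in> unit_disc \<Longrightarrow> norm (\<psi> z) \<le> 1;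
        \<And>z. z \<in> unit_disc \<Longrightarrow> (p has_field_derivative half_plane_map \<beta> (disc_aut (z * \<psi> z) lam * z)) (at z);
        \<And>z. z \<in> unit_disc \<Longrightarrow> (q has_field_derivative half_plane_map \<beta> (disc_aut (cis \<theta> * z) lam * z)) (at z);
        p 0 = q 0; w \<in> unit_disc; \<psi> w \<noteq> cis \<theta>\<rbrakk> \<Longrightarrow> Re ((q z0 - p z0) / \<nu>) > 0"
    using extremal_supports[OF norm_cis lam \<beta> z0] by blast
  show ?thesis
  proof (rule that[of \<nu>])
    fix f assume f: "f \<in> class_G \<alpha> \<beta> lam"
    have fA: "f \<in> class_A" using f by (simp add: class_G_def class_F_def)
    obtain \<psi> where \<psi>: "\<psi> holomorphic_on unit_disc" "\<And>z. z \<in> unit_disc \<Longrightarrow> norm (\<psi> z) \<le> 1"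
      "\<And>z. z \<in> unit_disc \<Longrightarrow> (alpha_op \<alpha> f has_field_derivative half_plane_map \<beta> (disc_aut (z * \<psi> z) lam * z)) (at z)"
      using class_G_parameter[OF \<alpha> \<beta> lam f] by blast
    have f0: "alpha_op \<alpha> f 0 = ?L 0" using fA by (simp add: alpha_op_def class_A_def)
    show "(\<forall>z\<in>unit_disc. f z = ?F z) \<or> Re ((alpha_op \<alpha> ?F z0 - alpha_op \<alpha> f z0) / \<nu>) > 0"
    proof (cases "\<exists>w\<in>unit_disc. \<psi> w \<noteq> cis \<theta>")
      case True
      then obtain w where "w \<in> unit_disc" "\<psi> w \<noteq> cis \<theta>" by blast
      then have "Re ((?L z0 - alpha_op \<alpha> f z0) / \<nu>) > 0"
        using \<nu>[OF \<psi> extremal_primitive_deriv[OF lam] f0] by blast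
      then show ?thesis using FL[of z0] z0 by simp
    next
      case False
      then have "\<And>z. z \<in> unit_disc \<Longrightarrow> (alpha_op \<alpha> f has_field_derivative half_plane_map \<beta> (disc_aut (cis \<theta> * z) lam * z)) (at z)"
        using \<psi>(3) by (metis mult.commute)
      from field_derivative_eq_imp_eq[OF this extremal_primitive_deriv[OF lam] f0]
      have "alpha_op \<alpha> f z = alpha_op \<alpha> ?F z" if "z \<in> unit_disc" for z
        using FL that by simp
      then have "f z = ?F z" if "z \<in> unit_disc" for z
        using alpha_op_inj[of f ?F \<alpha> z] fA FA \<alpha> that by (simp add: class_A_def)
      then show ?thesis by blast
    qed
  qed
qed

lemma alpha_op_cong:
  assumes "\<And>z. z \<in> unit_disc \<Longrightarrow> f z = g z" "z \<in> unit_disc"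
  shows "alpha_op \<alpha> f z = alpha_op \<alpha> g z"
proof -
  have "eventually (\<lambda>w. f w = g w) (nhds z)"
    using assms by (intro eventually_nhds_in_open[of unit_disc, THEN eventually_mono]) auto
  then show ?thesis
    using assms by (simp add: alpha_op_def deriv_cong_ev)
qed

text \<open>
  Otherwise the constant \<open>cis \<theta>\<close>, used as a competitor against \<open>cis \<theta>'\<close>, would give a nonzero
  difference of derivatives at every point of the punctured disc. The point \<open>1/2\<close> is an arbitrary one.
\<close>

lemma F_fun_eq_imp_cis_eq:
  assumes \<alpha>: "Re \<alpha> > 0" and \<beta>: "\<beta> < 1" and lam: "lam \<in> unit_disc"
    and eq: "\<And>z. z \<in> unit_disc \<Longrightarrow> F_fun \<alpha> \<beta> (cis \<theta>) lam z = F_fun \<alpha> \<beta> (cis \<theta>') lam z"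
  shows "cis \<theta> = cis \<theta>'"
proof -
  define w :: complex where "w = 1 / 2"
  have w: "w \<in> unit_disc" by (simp add: w_def)
  have L: "extremal_primitive \<beta> lam \<theta> z = extremal_primitive \<beta> lam \<theta>' z" if "z \<in> unit_disc" for z
    using alpha_op_cong[of "F_fun \<alpha> \<beta> (cis \<theta>) lam" "F_fun \<alpha> \<beta> (cis \<theta>') lam", OF eq that, of \<alpha>]
    unfolding F_fun_primitive(2)[OF \<alpha> lam that] .
  have "(extremal_primitive \<beta> lam \<theta>' has_field_derivative half_plane_map \<beta> (disc_aut (cis \<theta> * w) lam * w)) (at w)"
    by (rule has_field_derivative_transform_within_open[OF extremal_primitive_deriv[OF lam w], of unit_disc])
      (use L w in auto)
  then have "half_plane_map \<beta> (disc_aut (cis \<theta> * w) lam * w) = half_plane_map \<beta> (disc_aut (cis \<theta>' * w) lam * w)"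
    using extremal_primitive_deriv[OF lam w] DERIV_unique by blast
  then have "2 * (1 - of_real \<beta>) * (1 - cnj lam * lam) * cis \<theta>' * w\<^sup>2 *
     (kernel_ratio (cis \<theta>') lam (\<lambda>_. cis \<theta>) w / (extremal_den (cis \<theta>') lam w)\<^sup>2) = 0"
    using extremal_diff[OF norm_cis lam w, of "\<lambda>_. cis \<theta>" \<beta> \<theta>'] by (simp add: mult.commute)
  moreover have "2 * (1 - complex_of_real \<beta>) \<noteq> 0"
    by (rule two_one_minus_nonzero[OF \<beta>])
  moreover have "1 - cnj lam * lam \<noteq> 0"
    using one_plus_cnj_mult_nonzero[of lam "- lam"] lam by simp
  moreover have "extremal_den (cis \<theta>') lam w \<noteq> 0" using extremal_den_nonzero lam w by simp
  ultimately have "kernel_ratio (cis \<theta>') lam (\<lambda>_. cis \<theta>) w = 0"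
    by (simp add: w_def)
  then show ?thesis
    using kernel_ratio_pos[OF norm_cis lam w, of "\<lambda>_. cis \<theta>" \<theta>'] by fastforce
qed

section \<open>The boundary curve\<close>

lemma inj_on_cis: "inj_on cis {-pi<..pi}"
  by (rule inj_on_inverseI[of _ Arg]) (simp add: Arg_cis)

theorem corollary6p4:
  fixes \<alpha> lam z0 :: complex and \<beta> :: real
  assumes "0 \<le> \<beta>" and "\<beta> < 1"
    and "Re \<alpha> > 0"
    and "lam \<in> unit_disc"
    and "z0 \<in> unit_disc - {0}"
  shows "
    (let \<Gamma> = (\<lambda>\<theta>::real. alpha_op \<alpha> (F_fun \<alpha> \<beta> (cis \<theta>) lam) z0);
         J = (\<lambda>t::real. \<Gamma> (2 * pi * t - pi))
     in frontier (V_G \<alpha> \<beta> z0 lam) = \<Gamma> ` {-pi<..pi} \<and>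
        simple_path J \<and> pathfinish J = pathstart J \<and> path_image J = frontier (V_G \<alpha> \<beta> z0 lam)) \<and>
    (\<forall>\<theta>\<in>{-pi<..pi}.
       let e = cis (\<theta> / 2);
           b = Im (cnj lam * e);
           s = complex_of_real (sqrt (1 - b\<^sup>2));
           ib = \<i> * complex_of_real b
       in alpha_op \<alpha> (F_fun \<alpha> \<beta> (cis \<theta>) lam) z0 =
            (2 * of_real \<beta> - 1) * z0 +
            (1 - of_real \<beta>) * cis (- \<theta> / 2) / s *
              ((1 + cnj lam * e * (- s + ib)) * Ln (1 + e * z0 / (s - ib)) -
               (1 + cnj lam * e * (s + ib)) * Ln (1 - e * z0 / (s + ib)))) \<and>
    (\<forall>f \<in> class_G \<alpha> \<beta> lam. \<forall>\<theta>\<in>{-pi<..pi}.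
       alpha_op \<alpha> f z0 = alpha_op \<alpha> (F_fun \<alpha> \<beta> (cis \<theta>) lam) z0 \<longrightarrow>
       (\<forall>z\<in>unit_disc. f z = F_fun \<alpha> \<beta> (cis \<theta>) lam z))"
proof -
  note \<beta> = assms(2) and \<alpha> = assms(3) and lam = assms(4) and z0 = assms(5)
  have z0D: "z0 \<in> unit_disc" using z0 by blast
  let ?V = "V_G \<alpha> \<beta> z0 lam"
  define \<Gamma> where "\<Gamma> \<theta> = alpha_op \<alpha> (F_fun \<alpha> \<beta> (cis \<theta>) lam) z0" for \<theta>
  define J where "J t = \<Gamma> (2 * pi * t - pi)" for t
  have \<Gamma>L: "\<Gamma> \<theta> = extremal_primitive \<beta> lam \<theta> z0" for \<theta>
    unfolding \<Gamma>_def by (rule F_fun_primitive(2)[OF \<alpha> lam z0D])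
  have unique: "\<forall>z\<in>unit_disc. f z = F_fun \<alpha> \<beta> (cis \<theta>) lam z"
    if "f \<in> class_G \<alpha> \<beta> lam" "alpha_op \<alpha> f z0 = \<Gamma> \<theta>" for f \<theta>
    using extremal_exposed[OF \<alpha> \<beta> lam z0, of \<theta>] that unfolding \<Gamma>_def
    by (metis diff_self div_0 less_irrefl zero_complex.sel(1))
  have \<Gamma>V: "\<Gamma> \<theta> \<in> ?V" for \<theta>
    unfolding V_G_def \<Gamma>_def using F_fun_in_class_G[OF \<alpha> lam] by blast
  have cis_eq: "cis \<theta> = cis \<theta>'" if "\<Gamma> \<theta> = \<Gamma> \<theta>'" for \<theta> \<theta>'
    using F_fun_eq_imp_cis_eq[OF \<alpha> \<beta> lam] unique[OF F_fun_in_class_G[OF \<alpha> lam], of \<theta> \<theta>'] that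
    by (simp add: \<Gamma>_def)
  have \<Gamma>F: "\<Gamma> \<theta> \<in> frontier ?V" for \<theta>
  proof -
    obtain \<nu> where \<nu>: "\<And>f. f \<in> class_G \<alpha> \<beta> lam \<Longrightarrow> (\<forall>z\<in>unit_disc. f z = F_fun \<alpha> \<beta> (cis \<theta>) lam z) \<or>
      Re ((\<Gamma> \<theta> - alpha_op \<alpha> f z0) / \<nu>) > 0"
      using extremal_exposed[OF \<alpha> \<beta> lam z0] unfolding \<Gamma>_def by metis
    have half: "v = \<Gamma> \<theta> \<or> Re ((\<Gamma> \<theta> - v) / \<nu>) > 0" if "v \<in> ?V" for v
      using that \<nu> alpha_op_cong[OF _ z0D] unfolding V_G_def \<Gamma>_def by blast
    \<comment> \<open>If \<open>\<nu>\<close> were \<open>0\<close>, division by zero would turn the strict inequality into \<open>0 > 0\<close>, and all values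
      of \<open>\<Gamma>\<close> would coincide.\<close>
    have "\<nu> \<noteq> 0"
    proof
      assume "\<nu> = 0"
      then have "\<Gamma> 0 = \<Gamma> \<theta>" "\<Gamma> pi = \<Gamma> \<theta>" using half[OF \<Gamma>V] by auto
      then have "cis 0 = cis pi" using cis_eq by metis
      then show False by (simp add: complex_eq_iff)
    qed
    have "\<Gamma> \<theta> \<notin> interior ?V"
    proof
      assume "\<Gamma> \<theta> \<in> interior ?V"
      then obtain r where r: "r > 0" "cball (\<Gamma> \<theta>) r \<subseteq> ?V"
        by (auto simp: mem_interior_cball)
      \<comment> \<open>A point of the ball lying beyond the supporting line, in the direction of the outer normal.\<close>
      define v where "v = \<Gamma> \<theta> + of_real (r / norm \<nu>) * \<nu>"
      have "v \<in> ?V"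
        using r \<open>\<nu> \<noteq> 0\<close> by (intro subsetD[OF r(2)]) (simp add: v_def dist_norm norm_mult norm_divide)
      moreover have "(\<Gamma> \<theta> - v) / \<nu> = of_real (- (r / norm \<nu>))"
        using \<open>\<nu> \<noteq> 0\<close> by (simp add: v_def)
      then have "Re ((\<Gamma> \<theta> - v) / \<nu>) < 0"
        using r(1) \<open>\<nu> \<noteq> 0\<close> by simp
      ultimately show False using half[of v] by auto
    qed
    then show ?thesis
      using \<Gamma>V closure_subset by (auto simp: frontier_def)
  qed
  have cont: "continuous_on UNIV \<Gamma>"
    unfolding \<Gamma>L[abs_def] by (rule continuous_on_extremal_primitive[OF lam z0D])
  have "continuous_on {0..1} (\<lambda>t::real. 2 * pi * t - pi)"
    by (intro continuous_intros)
  from continuous_on_compose2[OF cont this] have "path J"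
    unfolding path_def J_def by simp
  have J01: "J 0 = J 1"
  proof -
    have "cis (- pi) = cis pi" by (simp add: complex_eq_iff)
    then show ?thesis by (simp add: J_def \<Gamma>_def)
  qed
  have \<Gamma>inj: "inj_on \<Gamma> {-pi<..pi}"
    using cis_eq inj_on_cis by (metis (mono_tags, lifting) inj_on_def)
  have Jinj: "s = t" if "J s = J t" "s \<in> {0<..1}" "t \<in> {0<..1}" for s t
  proof -
    have "2 * pi * s - pi = 2 * pi * t - pi"
      by (rule inj_onD[OF \<Gamma>inj]) (use that in \<open>auto simp: J_def\<close>)
    then show ?thesis by simp
  qed
  have "loop_free J"
    unfolding loop_free_def
  proof (intro ballI impI)
    fix s t :: real assume st: "s \<in> {0..1}" "t \<in> {0..1}" "J s = J t"
    show "s = t \<or> s = 0 \<and> t = 1 \<or> s = 1 \<and> t = 0"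
    proof (cases "s = 0 \<or> t = 0")
      case True
      have "r = 0 \<or> r = 1" if "J r = J 0" "r \<in> {0..1}" for r
        using Jinj[of r 1] that J01 by force
      then show ?thesis using True st by metis
    next
      case False
      then show ?thesis using Jinj[OF st(3)] st(1,2) by simp
    qed
  qed
  with \<open>path J\<close> have simple: "simple_path J" by (simp add: simple_path_def)
  have loop: "pathfinish J = pathstart J"
    using J01 by (simp add: pathfinish_def pathstart_def)
  have image: "path_image J = \<Gamma> ` {-pi<..pi}"
  proof (intro equalityI subsetI)
    fix x assume "x \<in> path_image J"
    then obtain t where "t \<in> {0..1}" "x = J t" by (auto simp: path_image_def)
    then have "\<exists>t\<in>{0<..1}. x = J t"
      using J01 by (cases "t = 0") (auto intro: bexI[of _ 1])
    then show "x \<in> \<Gamma> ` {-pi<..pi}" by (auto simp: J_def)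
  next
    fix x assume "x \<in> \<Gamma> ` {-pi<..pi}"
    then obtain \<theta> where \<theta>: "\<theta> \<in> {-pi<..pi}" "x = \<Gamma> \<theta>" by blast
    have "x = J ((\<theta> + pi) / (2 * pi))" by (simp add: J_def \<theta>(2))
    moreover have "(\<theta> + pi) / (2 * pi) \<in> {0..1}" using \<theta>(1) by (auto simp: field_simps)
    ultimately show "x \<in> path_image J" unfolding path_image_def by blast
  qed
  have "frontier ?V = path_image J"
    by (rule frontier_convex_eq_Jordan_curve[OF convex_V_G[OF \<beta> z0D] simple loop])
      (use \<Gamma>V \<Gamma>F in \<open>auto simp: image\<close>)
  then have "frontier ?V = \<Gamma> ` {-pi<..pi} \<and> simple_path J \<and> pathfinish J = pathstart J \<and>
      path_image J = frontier ?V"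
    using simple loop image by simp
  moreover have "\<forall>\<theta>\<in>{-pi<..pi}. \<Gamma> \<theta> = extremal_primitive \<beta> lam \<theta> z0"
    using \<Gamma>L by blast
  moreover have "\<forall>f \<in> class_G \<alpha> \<beta> lam. \<forall>\<theta>\<in>{-pi<..pi}. alpha_op \<alpha> f z0 = \<Gamma> \<theta> \<longrightarrow>
      (\<forall>z\<in>unit_disc. f z = F_fun \<alpha> \<beta> (cis \<theta>) lam z)"
    using unique by blast
  ultimately show ?thesis
    unfolding Let_def \<Gamma>_def J_def extremal_primitive_def by - (rule conjI, assumption, rule conjI)
qed

end
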